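(* Let $K\subset\mathbb R^D$ be a closed ball of positive radius as in the context, and let $g$ be $C^2$ on a neighborhood of $K$ as in the context. Fix $\kappa>0$, $\sigma>0$ and a nonempty compact realization $\widehat M_N\subset\mathbb R^D$ of the reconstructed set. Then $0<\underline\varepsilon_{\kappa,\sigma}<1$, and the kernel $P_{N,\kappa}$ satisfies $$P_{N,\kappa}(x,A)\ge\underline\varepsilon_{\kappa,\sigma}\frac{\mathrm{Leb}_D(A)}{|K|},\qquad x\in K,\ A\in\mathcal B(K).$$ Moreover, $P_{N,\kappa}$ is reversible with respect to $\widehat\nu_{N,\kappa}$, and $\widehat\nu_{N,\kappa}$ is its unique invariant probability measure. For every initial law $\rho$ on $K$ and every integer $m\ge0$, $$\|\rho P_{N,\kappa}^m-\widehat\nu_{N,\kappa}\|_{\mathrm{TV}}\le(1-\underline\varepsilon_{\kappa,\sigma})^m\|\rho-\widehat\nu_{N,\kappa}\|_{\mathrm{TV}}\le(1-\underline\varepsilon_{\kappa,\sigma})^m,$$ $$W_2(\rho P_{N,\kappa}^m,\widehat\nu_{N,\kappa})\le L_K(1-\underline\varepsilon_{\kappa,\sigma})^{m/2}.$$ Thus the chain is uniformly geometrically ergodic.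
   Context: $K=\overline B(z_0,R_0+3r)$ with $z_0\in\mathbb R^D$, $R_0>0$, $r>0$; $L_K:=\mathrm{diam}(K)=2(R_0+3r)$; $\mathrm{Leb}_D$ is Lebesgue measure and $|K|:=\mathrm{Leb}_D(K)$; $\mathcal B(K)$ is the Borel $\sigma$-algebra of $K$. $\|\cdot\|$ is the Euclidean norm and $d_A(x):=\inf_{a\in A}\|x-a\|$. $g$ is $C^2$ on a neighborhood of $K$, with $\sup_K\|\nabla g\|$, $\sup_K\|\nabla^2g\|_{\mathrm{op}}$ and $\mathrm{osc}_K(g):=\sup_Kg-\inf_Kg$ finite. $\chi:[0,\infty)\to[0,\infty)$ is a fixed nondecreasing $C^2$ function with $\chi(s)=s$ for $0\le s\le r^2$, $\chi(s)\ge r^2$ for $s\ge r^2$, $\chi(s)=\chi(4r^2)$ for $s\ge4r^2$, and $\sup|\chi'|<\infty$. $\Psi_{\widehat M_N}(x):=\chi(d_{\widehat M_N}(x)^2)$. The reconstructed set $\widehat M_N$ is regarded as a fixed nonempty compact set; no other geometric property of it is assumed. $\widehat\nu_{N,\kappa}$ is the probability measure on $K$ with Lebesgue density proportional to $\mathbf 1_K(x)\exp\{-g(x)-\frac\kappa2\Psi_{\widehat M_N}(x)\}$. Let $q_\sigma(z):=(2\pi\sigma^2)^{-D/2}e^{-\|z\|^2/(2\sigma^2)}$. For $x\in K$ set $a_{N,\kappa}(x,y):=\min\{1,\exp(g(x)-g(y)-\frac\kappa2[\Psi_{\widehat M_N}(y)-\Psi_{\widehat M_N}(x)])\}$ if $y\in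 K$, and $a_{N,\kappa}(x,y):=0$ if $y\notin K$. The kernel on $K$ is $$P_{N,\kappa}(x,dy):=q_\sigma(y-x)a_{N,\kappa}(x,y)\,dy+r_{N,\kappa}(x)\,\delta_x(dy),\qquad r_{N,\kappa}(x):=1-\int_{\mathbb R^D}q_\sigma(y-x)a_{N,\kappa}(x,y)\,dy.$$ Define $$\underline\varepsilon_{\kappa,\sigma}:=|K|(2\pi\sigma^2)^{-D/2}\exp\left\{-\frac{L_K^2}{2\sigma^2}-\mathrm{osc}_K(g)-\frac\kappa2\chi(4r^2)\right\}.$$ $\|\mu-\nu\|_{\mathrm{TV}}:=\sup_B|\mu(B)-\nu(B)|$, and $W_2$ is the 2-Wasserstein distance with Euclidean cost. $\rho P^m$ is the law after $m$ steps started from $\rho$. *)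

theory Defs
  imports "HOL-Probability.Probability"
begin

section \<open>Regularity of the data\<close>

text \<open>Derivatives at the endpoint \<open>0\<close> of the half-line are one-sided.\<close>

definition cutoff :: "real \<Rightarrow> (real \<Rightarrow> real) \<Rightarrow> bool" where
  "cutoff r \<phi> \<longleftrightarrow>
     mono_on {0..} \<phi> \<and> (\<forall>s\<ge>0. \<phi> s \<ge> 0) \<and>
     (\<exists>\<phi>' D\<phi>'.
        (\<forall>s\<ge>0. (\<phi> has_real_derivative \<phi>' s) (at s within {0..})) \<and>
        (\<forall>s\<ge>0. (\<phi>' has_real_derivative D\<phi>' s) (at s within {0..})) \<and>
        continuous_on {0..} D\<phi>' \<and> bounded (\<phi>' ` {0..})) \<and>
     (\<forall>s. 0 \<le> s \<and> s \<le> r\<^sup>2 \<longrightarrow> \<phi> s = s) \<and>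
     (\<forall>s\<ge>r\<^sup>2. \<phi> s \<ge> r\<^sup>2) \<and>
     (\<forall>s\<ge>4 * r\<^sup>2. \<phi> s = \<phi> (4 * r\<^sup>2))"

text \<open>\<open>G\<close> is the gradient and \<open>H\<close> the Hessian of \<open>g\<close>.\<close>

definition C2_on ::
  "'a::euclidean_space set \<Rightarrow> ('a \<Rightarrow> real) \<Rightarrow> ('a \<Rightarrow> 'a) \<Rightarrow> ('a \<Rightarrow> 'a \<Rightarrow>\<^sub>L 'a) \<Rightarrow> bool" where
  "C2_on U g G H \<longleftrightarrow>
     (\<forall>x\<in>U. GDERIV g x :> G x) \<and>
     (\<forall>x\<in>U. (G has_derivative blinfun_apply (H x)) (at x)) \<and>
     continuous_on U H"

definition osc_on :: "'a set \<Rightarrow> ('a \<Rightarrow> real) \<Rightarrow> real" where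
  "osc_on K g = (SUP x\<in>K. g x) - (INF x\<in>K. g x)"

section \<open>Target measure and Metropolis kernel\<close>

definition penalty :: "(real \<Rightarrow> real) \<Rightarrow> 'a::euclidean_space set \<Rightarrow> 'a \<Rightarrow> real" where
  "penalty \<phi> M x = \<phi> ((infdist x M)\<^sup>2)"

definition target ::
  "'a::euclidean_space set \<Rightarrow> ('a \<Rightarrow> real) \<Rightarrow> ('a \<Rightarrow> real) \<Rightarrow> real \<Rightarrow> 'a measure" where
  "target K g \<Psi> \<kappa> =
     density (restrict_space lborel K)
       (\<lambda>x. ennreal (exp (- g x - \<kappa> / 2 * \<Psi> x) / (LINT y:K|lborel. exp (- g y - \<kappa> / 2 * \<Psi> y))))"

definition gauss :: "real \<Rightarrow> 'a::euclidean_space \<Rightarrow> real" where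
  "gauss \<sigma> z = (2 * pi * \<sigma>\<^sup>2) powr (- real DIM('a) / 2) * exp (- (norm z)\<^sup>2 / (2 * \<sigma>\<^sup>2))"

definition accept ::
  "'a::euclidean_space set \<Rightarrow> ('a \<Rightarrow> real) \<Rightarrow> ('a \<Rightarrow> real) \<Rightarrow> real \<Rightarrow> 'a \<Rightarrow> 'a \<Rightarrow> real" where
  "accept K g \<Psi> \<kappa> x y =
     (if y \<in> K then min 1 (exp (g x - g y - \<kappa> / 2 * (\<Psi> y - \<Psi> x))) else 0)"

definition reject ::
  "'a::euclidean_space set \<Rightarrow> ('a \<Rightarrow> real) \<Rightarrow> ('a \<Rightarrow> real) \<Rightarrow> real \<Rightarrow> real \<Rightarrow> 'a \<Rightarrow> real" where
  "reject K g \<Psi> \<kappa> \<sigma> x = 1 - (LINT y|lborel. gauss \<sigma> (y - x) * accept K g \<Psi> \<kappa> x y)"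

definition mh_kernel ::
  "'a::euclidean_space set \<Rightarrow> ('a \<Rightarrow> real) \<Rightarrow> ('a \<Rightarrow> real) \<Rightarrow> real \<Rightarrow> real \<Rightarrow> 'a \<Rightarrow> 'a measure" where
  "mh_kernel K g \<Psi> \<kappa> \<sigma> x =
     measure_of K (sets (restrict_space borel K))
       (\<lambda>A. emeasure (density lborel (\<lambda>y. ennreal (gauss \<sigma> (y - x) * accept K g \<Psi> \<kappa> x y))) A
          + ennreal (reject K g \<Psi> \<kappa> \<sigma> x) * emeasure (return borel x) A)"

text \<open>Since \<^const>\<open>measure_of\<close> returns the zero measure on set functions that are not measures,
  we check that the set function above is one.\<close>

lemma sets_mh_kernel: "sets (mh_kernel K g \<Psi> \<kappa> \<sigma> x) = sets (restrict_space borel K)"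
proof -
  have "sigma_sets K (sets (restrict_space borel K)) = sets (restrict_space borel K)"
    by (metis sets.sigma_sets_eq space_restrict_space2 space_borel inf_top.right_neutral
        space_restrict_space)
  moreover have "sets (restrict_space borel K) \<subseteq> Pow K"
    by (auto simp: sets_restrict_space)
  ultimately show ?thesis by (simp add: mh_kernel_def)
qed

lemma emeasure_mh_kernel:
  assumes K: "K \<in> sets borel" and A: "A \<in> sets (restrict_space borel K)"
  shows "emeasure (mh_kernel K g \<Psi> \<kappa> \<sigma> x) A =
    emeasure (density lborel (\<lambda>y. ennreal (gauss \<sigma> (y - x) * accept K g \<Psi> \<kappa> x y))) A
    + ennreal (reject K g \<Psi> \<kappa> \<sigma> x) * emeasure (return borel x) A" (is "_ = ?f A")
proof (rule emeasure_measure_of[OF mh_kernel_def])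
  have sub: "B \<in> sets borel" if "B \<in> sets (restrict_space borel K)" for B
    using that K by (auto simp: sets_restrict_space)
  show "sets (restrict_space borel K) \<subseteq> Pow K"
    by (auto simp: sets_restrict_space)
  show "A \<in> sets (mh_kernel K g \<Psi> \<kappa> \<sigma> x)"
    using A by (simp add: sets_mh_kernel)
  show "positive (sets (mh_kernel K g \<Psi> \<kappa> \<sigma> x)) ?f"
    by (simp add: positive_def)
  show "countably_additive (sets (mh_kernel K g \<Psi> \<kappa> \<sigma> x)) ?f"
  proof (rule countably_additiveI)
    fix B :: "nat \<Rightarrow> 'a set"
    assume B: "range B \<subseteq> sets (mh_kernel K g \<Psi> \<kappa> \<sigma> x)" and d: "disjoint_family B"
    have b: "range B \<subseteq> sets borel"
      using B sub by (auto simp: sets_mh_kernel)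
    have 1: "(\<Sum>i. emeasure (density lborel (\<lambda>y. ennreal (gauss \<sigma> (y - x) * accept K g \<Psi> \<kappa> x y))) (B i))
       = emeasure (density lborel (\<lambda>y. ennreal (gauss \<sigma> (y - x) * accept K g \<Psi> \<kappa> x y))) (\<Union>i. B i)"
      by (rule suminf_emeasure) (use b d in auto)
    have 2: "(\<Sum>i. emeasure (return borel x) (B i)) = emeasure (return borel x) (\<Union>i. B i)"
      by (rule suminf_emeasure) (use b d in auto)
    show "(\<Sum>i. ?f (B i)) = ?f (\<Union>i. B i)"
      by (simp only: suminf_add[symmetric] ennreal_suminf_cmult 1 2 summableI)
  qed
qed

definition minor_const ::
  "'a::euclidean_space set \<Rightarrow> ('a \<Rightarrow> real) \<Rightarrow> (real \<Rightarrow> real) \<Rightarrow> real \<Rightarrow> real \<Rightarrow> real \<Rightarrow> real" where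
  "minor_const K g \<phi> r \<kappa> \<sigma> =
     measure lborel K * (2 * pi * \<sigma>\<^sup>2) powr (- real DIM('a) / 2) *
     exp (- (diameter K)\<^sup>2 / (2 * \<sigma>\<^sup>2) - osc_on K g - \<kappa> / 2 * \<phi> (4 * r\<^sup>2))"

section \<open>Markov chains on a set\<close>

definition law_on :: "'a::topological_space set \<Rightarrow> 'a measure \<Rightarrow> bool" where
  "law_on K \<rho> \<longleftrightarrow> prob_space \<rho> \<and> sets \<rho> = sets (restrict_space borel K)"

definition step_law :: "('a \<Rightarrow> 'a measure) \<Rightarrow> nat \<Rightarrow> 'a measure \<Rightarrow> 'a measure" where
  "step_law P m \<rho> = ((\<lambda>\<mu>. bind \<mu> P) ^^ m) \<rho>"

definition invariant_law :: "('a \<Rightarrow> 'a measure) \<Rightarrow> 'a measure \<Rightarrow> bool" where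
  "invariant_law P \<mu> \<longleftrightarrow> bind \<mu> P = \<mu>"

definition reversible_law :: "('a \<Rightarrow> 'a measure) \<Rightarrow> 'a measure \<Rightarrow> bool" where
  "reversible_law P \<mu> \<longleftrightarrow>
     (\<forall>A\<in>sets \<mu>. \<forall>B\<in>sets \<mu>.
        (\<integral>\<^sup>+x\<in>A. emeasure (P x) B \<partial>\<mu>) = (\<integral>\<^sup>+x\<in>B. emeasure (P x) A \<partial>\<mu>))"

definition tv_dist :: "'a measure \<Rightarrow> 'a measure \<Rightarrow> real" where
  "tv_dist \<mu> \<nu> = (SUP B\<in>sets \<mu>. \<bar>measure \<mu> B - measure \<nu> B\<bar>)"

definition couplings :: "'a measure \<Rightarrow> 'a measure \<Rightarrow> ('a \<times> 'a) measure set" where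
  "couplings \<mu> \<nu> =
     {\<pi>. prob_space \<pi> \<and> sets \<pi> = sets (\<mu> \<Otimes>\<^sub>M \<nu>) \<and> distr \<pi> \<mu> fst = \<mu> \<and> distr \<pi> \<nu> snd = \<nu>}"

text \<open>The cost is kept in \<^typ>\<open>ennreal\<close>, so that an infinite cost is not
  mistaken for \<open>0\<close>.\<close>

definition wasserstein2 ::
  "'a::metric_space measure \<Rightarrow> 'a measure \<Rightarrow> ennreal" where
  "wasserstein2 \<mu> \<nu> =
     (let c = (INF \<pi>\<in>couplings \<mu> \<nu>. \<integral>\<^sup>+z. ennreal ((dist (fst z) (snd z))\<^sup>2) \<partial>\<pi>)
      in if c = \<top> then \<top> else ennreal (sqrt (enn2real c)))"

definition uniformly_geometrically_ergodic ::
  "'a::topological_space set \<Rightarrow> ('a \<Rightarrow> 'a measure) \<Rightarrow> 'a measure \<Rightarrow> bool" where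
  "uniformly_geometrically_ergodic K P \<nu> \<longleftrightarrow>
     (\<exists>C q. 0 \<le> C \<and> 0 \<le> q \<and> q < 1 \<and>
        (\<forall>x\<in>K. \<forall>m. tv_dist (step_law P m (return (restrict_space borel K) x)) \<nu> \<le> C * q ^ m))"

end

theory Submission
  imports Defs
begin

text \<open>
  The mathematics is Doeblin's argument, run for the Metropolis kernel on a compact set.

  Write \<open>E = g + \<kappa>/2 \<Psi>\<close>, so that the target density is proportional to \<open>exp (- E)\<close>. On \<open>K\<close> the
  energy \<open>E\<close> varies by at most \<open>c = osc g + \<kappa>/2 \<phi>(4 r\<^sup>2)\<close> and two points are at distance at most
  the diameter \<open>L\<close> of \<open>K\<close>. The accepted part of a step from any \<open>x \<in> K\<close> therefore has a Lebesgue
  density on \<open>K\<close> bounded below by the constant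
  \<open>(2 \<pi> \<sigma>\<^sup>2)\<^bsup>-D/2\<^esup> exp (- L\<^sup>2 / (2 \<sigma>\<^sup>2) - c)\<close>, and \<open>\<epsilon>\<close> is this constant times the volume of \<open>K\<close>:
  with probability at least \<open>\<epsilon>\<close> the chain forgets its position and is renewed uniformly on \<open>K\<close>
  (\<open>measure_P_ge\<close>). That \<open>\<epsilon> < 1\<close> holds strictly is due to the penalty: the Gaussian proposal alone
  gives mass at most \<open>1\<close> to \<open>K\<close>, and \<open>c \<ge> \<kappa>/2 \<phi>(4 r\<^sup>2) > 0\<close> contributes a further factor
  \<open>exp (- c) < 1\<close> (\<open>minorizing_mass_less_1\<close>).

  Such a minorization contracts total variation by \<open>1 - \<epsilon>\<close> (\<open>tv_dist_bind_le\<close>): the function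
  \<open>x \<mapsto> P x B - \<epsilon> \<eta> B\<close> takes values in \<open>[0, 1 - \<epsilon>]\<close>, and the integrals of a function with values in
  \<open>[0, b]\<close> against two laws differ by at most \<open>b\<close> times their total variation distance
  (\<open>nn_integral_le_add_tv_dist\<close>). Detailed balance (\<open>detailed_balance\<close>) and Tonelli's theorem
  make the target reversible, hence invariant; contraction then makes it the only invariant law and
  gives the geometric rate.

  For the Wasserstein bound, two laws on \<open>K\<close> have a coupling that leaves the diagonal with
  probability at most their total variation distance (\<open>ex_coupling_off_diagonal\<close>); off the diagonal
  the squared distance is at most \<open>L\<^sup>2\<close>. So \<open>W\<^sub>2\<close> is at most \<open>L\<close> times the square root of the total
  variation distance, which is where the exponent \<open>m/2\<close> comes from.
\<close>

section \<open>Total variation distance\<close>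

lemma tv_dist_upper:
  assumes "prob_space \<mu>" and "prob_space \<nu>" and "B \<in> sets \<mu>"
  shows "\<bar>measure \<mu> B - measure \<nu> B\<bar> \<le> tv_dist \<mu> \<nu>"
proof -
  interpret \<mu>: prob_space \<mu> by fact
  interpret \<nu>: prob_space \<nu> by fact
  have "bdd_above ((\<lambda>B. \<bar>measure \<mu> B - measure \<nu> B\<bar>) ` sets \<mu>)"
  proof (rule bdd_aboveI2)
    show "\<bar>measure \<mu> B - measure \<nu> B\<bar> \<le> 1" for B
      using \<mu>.prob_le_1[of B] \<nu>.prob_le_1[of B] measure_nonneg[of \<mu> B] measure_nonneg[of \<nu> B]
      by linarith
  qed
  then show ?thesis
    unfolding tv_dist_def using assms(3) by (rule cSUP_upper2) simp
qed

lemma tv_dist_least: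
  assumes "\<And>B. B \<in> sets \<mu> \<Longrightarrow> \<bar>measure \<mu> B - measure \<nu> B\<bar> \<le> c"
  shows "tv_dist \<mu> \<nu> \<le> c"
  unfolding tv_dist_def by (rule cSUP_least) (use assms in auto)

lemma tv_dist_nonneg:
  assumes "prob_space \<mu>" and "prob_space \<nu>"
  shows "0 \<le> tv_dist \<mu> \<nu>"
  using tv_dist_upper[OF assms, of "{}"] by simp

lemma tv_dist_le_1:
  assumes "prob_space \<mu>" and "prob_space \<nu>"
  shows "tv_dist \<mu> \<nu> \<le> 1"
proof (rule tv_dist_least)
  interpret \<mu>: prob_space \<mu> by fact
  interpret \<nu>: prob_space \<nu> by fact
  show "\<bar>measure \<mu> B - measure \<nu> B\<bar> \<le> 1" for B
    using \<mu>.prob_le_1[of B] \<nu>.prob_le_1[of B] measure_nonneg[of \<mu> B] measure_nonneg[of \<nu> B]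
    by linarith
qed

lemma tv_dist_commute:
  assumes "sets \<mu> = sets \<nu>"
  shows "tv_dist \<mu> \<nu> = tv_dist \<nu> \<mu>"
  using assms by (simp add: tv_dist_def abs_minus_commute)

lemma eq_measure_if_tv_dist_eq_0:
  assumes "prob_space \<mu>" and "prob_space \<nu>" and "sets \<mu> = sets \<nu>" and "tv_dist \<mu> \<nu> = 0"
  shows "\<mu> = \<nu>"
proof (rule measure_eqI)
  interpret \<mu>: prob_space \<mu> by fact
  interpret \<nu>: prob_space \<nu> by fact
  show "emeasure \<mu> A = emeasure \<nu> A" if "A \<in> sets \<mu>" for A
    using tv_dist_upper[OF assms(1,2) that] assms(4)
    by (simp add: \<mu>.emeasure_eq_measure \<nu>.emeasure_eq_measure)
qed fact

lemma nn_integral_layer_cake: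
  assumes "sigma_finite_measure \<mu>" and f[measurable]: "f \<in> borel_measurable \<mu>"
    and "\<And>x. x \<in> space \<mu> \<Longrightarrow> 0 \<le> f x"
  shows "(\<integral>\<^sup>+x. ennreal (f x) \<partial>\<mu>) =
    (\<integral>\<^sup>+t. indicator {0..} t * emeasure \<mu> {x \<in> space \<mu>. t < f x} \<partial>lborel)"
proof -
  interpret sigma_finite_measure \<mu> by fact
  interpret pair_sigma_finite \<mu> lborel ..
  have "(\<integral>\<^sup>+x. ennreal (f x) \<partial>\<mu>) = (\<integral>\<^sup>+x. (\<integral>\<^sup>+t. indicator {0..<f x} t \<partial>lborel) \<partial>\<mu>)"
    using assms(3) by (intro nn_integral_cong) simp
  also have "\<dots> = (\<integral>\<^sup>+x. (\<integral>\<^sup>+t. (if 0 \<le> t \<and> t < f x then 1 else 0) \<partial>lborel) \<partial>\<mu>)"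
    by (intro nn_integral_cong) (auto simp: indicator_def)
  also have "\<dots> = (\<integral>\<^sup>+t. (\<integral>\<^sup>+x. (if 0 \<le> t \<and> t < f x then 1 else 0) \<partial>\<mu>) \<partial>lborel)"
    by (rule Fubini'[symmetric]) measurable
  also have "\<dots> = (\<integral>\<^sup>+t. (\<integral>\<^sup>+x. indicator {0..} t * indicator {x \<in> space \<mu>. t < f x} x \<partial>\<mu>) \<partial>lborel)"
    by (intro nn_integral_cong) (auto simp: indicator_def)
  also have "\<dots> = (\<integral>\<^sup>+t. indicator {0..} t * emeasure \<mu> {x \<in> space \<mu>. t < f x} \<partial>lborel)"
    by (intro nn_integral_cong) (simp add: nn_integral_cmult)
  finally show ?thesis .
qed

text \<open>By the layer cake formula the integral of \<open>f\<close> is the integral over \<open>t \<ge> 0\<close> of the measure of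
  \<open>{f > t}\<close>. Exchanging \<open>\<mu>\<close> for \<open>\<nu>\<close> costs at most the total variation distance at each level, and
  only the levels \<open>t \<le> c\<close> contribute.\<close>

lemma nn_integral_le_add_tv_dist:
  assumes "prob_space \<mu>" and "prob_space \<nu>" and sets[measurable_cong]: "sets \<mu> = sets \<nu>"
    and f[measurable]: "f \<in> borel_measurable \<mu>"
    and fc: "\<And>x. x \<in> space \<mu> \<Longrightarrow> 0 \<le> f x \<and> f x \<le> c" and "0 \<le> c"
  shows "(\<integral>\<^sup>+x. ennreal (f x) \<partial>\<mu>) \<le> (\<integral>\<^sup>+x. ennreal (f x) \<partial>\<nu>) + ennreal (c * tv_dist \<mu> \<nu>)"
proof -
  interpret \<mu>: prob_space \<mu> by fact
  interpret \<nu>: prob_space \<nu> by fact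
  interpret pair_sigma_finite \<nu> "lborel :: real measure" ..
  note sp = sets_eq_imp_space_eq[OF sets]
  have fn: "f \<in> borel_measurable \<nu>" using f measurable_cong_sets[OF sets refl] by simp
  have pt: "emeasure \<mu> {x \<in> space \<mu>. t < f x} \<le>
      emeasure \<nu> {x \<in> space \<nu>. t < f x} + ennreal (tv_dist \<mu> \<nu>) * indicator {..c} t" for t
  proof (cases "t \<le> c")
    case True
    have "{x \<in> space \<mu>. t < f x} \<in> sets \<mu>" by measurable
    from tv_dist_upper[OF assms(1,2) this] show ?thesis using True
      by (simp add: \<mu>.emeasure_eq_measure \<nu>.emeasure_eq_measure sp flip: ennreal_plus
          add: tv_dist_nonneg[OF assms(1,2)])
  next
    case False
    then have "{x \<in> space \<mu>. t < f x} = {}" using fc by force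
    then show ?thesis by (simp only: emeasure_empty zero_le)
  qed
  have m: "(\<lambda>t. emeasure \<nu> {x \<in> space \<nu>. t < f x}) \<in> borel_measurable (lborel :: real measure)"
    using fn by measurable
  have "(\<integral>\<^sup>+x. ennreal (f x) \<partial>\<mu>) =
    (\<integral>\<^sup>+t. indicator {0..} t * emeasure \<mu> {x \<in> space \<mu>. t < f x} \<partial>lborel)"
    using fc by (intro nn_integral_layer_cake) (auto intro: \<mu>.sigma_finite_measure_axioms)
  also have "\<dots> \<le> (\<integral>\<^sup>+t. indicator {0..} t * emeasure \<nu> {x \<in> space \<nu>. t < f x} +
      ennreal (tv_dist \<mu> \<nu>) * indicator {0..c} t \<partial>lborel)"
    by (intro nn_integral_mono) (use pt in \<open>auto simp: indicator_def split: if_splits\<close>)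
  also have "\<dots> = (\<integral>\<^sup>+t. indicator {0..} t * emeasure \<nu> {x \<in> space \<nu>. t < f x} \<partial>lborel) +
      ennreal (tv_dist \<mu> \<nu>) * ennreal c"
    using m \<open>0 \<le> c\<close> by (subst nn_integral_add) (auto simp: nn_integral_cmult)
  also have "\<dots> = (\<integral>\<^sup>+x. ennreal (f x) \<partial>\<nu>) + ennreal (c * tv_dist \<mu> \<nu>)"
    using fc fn sp \<open>0 \<le> c\<close>
    by (subst nn_integral_layer_cake)
      (auto intro: \<nu>.sigma_finite_measure_axioms
        simp: ennreal_mult tv_dist_nonneg[OF assms(1,2)] mult.commute)
  finally show ?thesis .
qed

section \<open>Maximal couplings and the Wasserstein distance\<close>

definition add_measure :: "'a measure \<Rightarrow> 'a measure \<Rightarrow> 'a measure" where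
  "add_measure M N = measure_of (space M) (sets M) (\<lambda>A. emeasure M A + emeasure N A)"

lemma sets_add_measure [simp]: "sets (add_measure M N) = sets M"
  by (simp add: add_measure_def)

lemma space_add_measure [simp]: "space (add_measure M N) = space M"
  by (simp add: add_measure_def)

lemma emeasure_add_measure:
  assumes "sets N = sets M" and "A \<in> sets M"
  shows "emeasure (add_measure M N) A = emeasure M A + emeasure N A"
unfolding add_measure_def
proof (rule emeasure_measure_of_sigma)
  show "countably_additive (sets M) (\<lambda>A. emeasure M A + emeasure N A)"
  proof (rule countably_additiveI)
    fix B :: "nat \<Rightarrow> _" assume B: "range B \<subseteq> sets M" "disjoint_family B"
    have "(\<Sum>i. emeasure M (B i)) = emeasure M (\<Union>i. B i)"
      "(\<Sum>i. emeasure N (B i)) = emeasure N (\<Union>i. B i)"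
      using B assms(1) by (auto intro!: suminf_emeasure)
    then show "(\<Sum>i. emeasure M (B i) + emeasure N (B i)) =
        emeasure M (\<Union>i. B i) + emeasure N (\<Union>i. B i)"
      by (simp only: suminf_add[symmetric] summableI)
  qed
qed (use assms in \<open>auto simp: positive_def intro: sets.sigma_algebra_axioms\<close>)

text \<open>The common part is the pointwise minimum of the two laws: on a Hahn decomposition
  \<open>{Y, - Y}\<close> it equals \<open>\<nu>\<close> where \<open>\<nu>\<close> is the smaller one and \<open>\<mu>\<close> elsewhere. Its missing mass is
  \<open>\<mu> Y - \<nu> Y\<close>, a difference that the total variation distance bounds.\<close>

lemma ex_common_part:
  assumes "prob_space \<mu>" and "prob_space \<nu>" and sets: "sets \<nu> = sets \<mu>"
  obtains \<alpha> where "sets \<alpha> = sets \<mu>"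
    "\<And>A. A \<in> sets \<mu> \<Longrightarrow> emeasure \<alpha> A \<le> emeasure \<mu> A"
    "\<And>A. A \<in> sets \<mu> \<Longrightarrow> emeasure \<alpha> A \<le> emeasure \<nu> A"
    "1 - tv_dist \<mu> \<nu> \<le> measure \<alpha> (space \<mu>)"
proof -
  interpret \<mu>: prob_space \<mu> by fact
  interpret \<nu>: prob_space \<nu> by fact
  obtain Y where Y[measurable]: "Y \<in> sets \<mu>"
    and le: "\<And>X. X \<in> sets \<mu> \<Longrightarrow> X \<subseteq> Y \<Longrightarrow> emeasure \<nu> X \<le> emeasure \<mu> X"
    and ge: "\<And>X. X \<in> sets \<mu> \<Longrightarrow> X \<inter> Y = {} \<Longrightarrow> emeasure \<mu> X \<le> emeasure \<nu> X"
    using finite_unsigned_Hahn_decomposition[OF \<mu>.finite_measure_axioms \<nu>.finite_measure_axioms sets]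
    by auto
  define \<alpha> where "\<alpha> = add_measure (density \<nu> (indicator Y)) (density \<mu> (indicator (space \<mu> - Y)))"
  have Yn[measurable]: "Y \<in> sets \<nu>" "space \<mu> - Y \<in> sets \<nu>" using sets by auto
  have em: "emeasure \<alpha> A = emeasure \<nu> (A \<inter> Y) + emeasure \<mu> (A - Y)" if [measurable]: "A \<in> sets \<mu>" for A
  proof -
    have [measurable]: "A \<in> sets \<nu>" using sets that by simp
    have "(\<integral>\<^sup>+x. indicator (space \<mu> - Y) x * indicator A x \<partial>\<mu>) = (\<integral>\<^sup>+x. indicator (A - Y) x \<partial>\<mu>)"
      using sets.sets_into_space[OF that]
      by (intro nn_integral_cong) (auto simp: indicator_def)
    moreover have "(\<integral>\<^sup>+x. indicator Y x * indicator A x \<partial>\<nu>) = (\<integral>\<^sup>+x. indicator (A \<inter> Y) x \<partial>\<nu>)"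
      by (intro nn_integral_cong) (auto simp: indicator_def)
    ultimately show ?thesis
      by (simp add: \<alpha>_def emeasure_add_measure sets emeasure_density)
  qed
  have split_\<mu>: "emeasure \<mu> A = emeasure \<mu> (A \<inter> Y) + emeasure \<mu> (A - Y)" if "A \<in> sets \<mu>" for A
    using that by (subst plus_emeasure) (auto intro!: arg_cong[where f = "emeasure \<mu>"])
  have split_\<nu>: "emeasure \<nu> A = emeasure \<nu> (A \<inter> Y) + emeasure \<nu> (A - Y)" if "A \<in> sets \<mu>" for A
    using that sets by (subst plus_emeasure) (auto intro!: arg_cong[where f = "emeasure \<nu>"])
  show ?thesis
  proof
    show "sets \<alpha> = sets \<mu>" by (simp add: \<alpha>_def sets)
    show "emeasure \<alpha> A \<le> emeasure \<mu> A" if "A \<in> sets \<mu>" for A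
      unfolding em[OF that] split_\<mu>[OF that] using that by (intro add_right_mono le) auto
    show "emeasure \<alpha> A \<le> emeasure \<nu> A" if "A \<in> sets \<mu>" for A
      unfolding em[OF that] split_\<nu>[OF that] using that by (intro add_left_mono ge) auto
    have "emeasure \<alpha> (space \<mu>) = ennreal (measure \<nu> Y + (1 - measure \<mu> Y))"
      using sets.sets_into_space[OF Y]
      by (simp add: em Int_absorb1 \<mu>.emeasure_eq_measure \<nu>.emeasure_eq_measure \<mu>.prob_compl)
    then have "measure \<alpha> (space \<mu>) = measure \<nu> Y + (1 - measure \<mu> Y)"
      by (intro measure_eq_emeasure_eq_ennreal) (simp_all add: \<mu>.prob_le_1)
    then show "1 - tv_dist \<mu> \<nu> \<le> measure \<alpha> (space \<mu>)"
      using tv_dist_upper[OF assms(1,2) Y] by linarith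
  qed
qed

text \<open>The maximal coupling: the common part \<open>\<alpha>\<close> is placed on the diagonal, and the two remainders
  \<open>\<mu> - \<alpha>\<close> and \<open>\<nu> - \<alpha>\<close>, which have equal mass \<open>t\<close>, are coupled independently. Only the second
  piece, of mass \<open>t\<close>, can charge the complement of the diagonal.\<close>

lemma ex_coupling_off_diagonal:
  fixes \<mu> \<nu> :: "'a measure"
  assumes "prob_space \<mu>" and "prob_space \<nu>" and sets: "sets \<nu> = sets \<mu>"
    and diag: "{z \<in> space (\<mu> \<Otimes>\<^sub>M \<nu>). fst z \<noteq> snd z} \<in> sets (\<mu> \<Otimes>\<^sub>M \<nu>)" (is "?D \<in> _")
  obtains \<pi> where "\<pi> \<in> couplings \<mu> \<nu>" "emeasure \<pi> ?D \<le> ennreal (tv_dist \<mu> \<nu>)"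
proof -
  interpret \<mu>: prob_space \<mu> by fact
  interpret \<nu>: prob_space \<nu> by fact
  obtain \<alpha> where s: "sets \<alpha> = sets \<mu>"
    and \<alpha>\<mu>: "\<And>A. A \<in> sets \<mu> \<Longrightarrow> emeasure \<alpha> A \<le> emeasure \<mu> A"
    and \<alpha>\<nu>: "\<And>A. A \<in> sets \<mu> \<Longrightarrow> emeasure \<alpha> A \<le> emeasure \<nu> A"
    and \<alpha>tv: "1 - tv_dist \<mu> \<nu> \<le> measure \<alpha> (space \<mu>)"
    using ex_common_part[OF assms(1-3)] by blast
  note sp = sets_eq_imp_space_eq[OF sets] sets_eq_imp_space_eq[OF s]
  have "emeasure \<alpha> (space \<alpha>) \<le> 1" using \<alpha>\<mu>[of "space \<mu>"] sp \<mu>.emeasure_space_1 by simp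
  then have fin: "finite_measure \<alpha>" by (intro finite_measureI) (auto simp: top_unique)
  interpret \<alpha>: finite_measure \<alpha> by fact
  define t where "t = 1 - measure \<alpha> (space \<mu>)"
  have t0: "0 \<le> t" using \<open>emeasure \<alpha> (space \<alpha>) \<le> 1\<close> sp by (simp add: t_def \<alpha>.emeasure_eq_measure)
  define \<beta>\<mu> where "\<beta>\<mu> = diff_measure \<mu> \<alpha>"
  define \<beta>\<nu> where "\<beta>\<nu> = diff_measure \<nu> \<alpha>"
  have b\<mu>: "emeasure \<beta>\<mu> A = emeasure \<mu> A - emeasure \<alpha> A" if "A \<in> sets \<mu>" for A
    unfolding \<beta>\<mu>_def using that s \<alpha>\<mu>
    by (intro emeasure_diff_measure) (auto intro: fin \<mu>.finite_measure_axioms)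
  have b\<nu>: "emeasure \<beta>\<nu> A = emeasure \<nu> A - emeasure \<alpha> A" if "A \<in> sets \<mu>" for A
    unfolding \<beta>\<nu>_def using that s \<alpha>\<nu> sets
    by (intro emeasure_diff_measure) (auto intro: fin \<nu>.finite_measure_axioms)
  have sb[simp]: "sets \<beta>\<mu> = sets \<mu>" "sets \<beta>\<nu> = sets \<mu>" "space \<beta>\<mu> = space \<mu>" "space \<beta>\<nu> = space \<mu>"
    by (simp_all add: \<beta>\<mu>_def \<beta>\<nu>_def sets sp)
  have mass: "emeasure \<beta>\<mu> (space \<mu>) = ennreal t" "emeasure \<beta>\<nu> (space \<mu>) = ennreal t"
    using \<nu>.emeasure_space_1 sp
    by (simp_all add: b\<mu> b\<nu> \<mu>.emeasure_space_1 \<alpha>.emeasure_eq_measure t_def ennreal_minus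
        flip: ennreal_1)
  interpret \<beta>\<mu>: finite_measure \<beta>\<mu> by (rule finite_measureI) (simp add: mass)
  interpret \<beta>\<nu>: finite_measure \<beta>\<nu> by (rule finite_measureI) (simp add: mass)
  have sp2: "sets (\<mu> \<Otimes>\<^sub>M \<nu>) = sets (\<alpha> \<Otimes>\<^sub>M \<alpha>)" "sets (\<beta>\<mu> \<Otimes>\<^sub>M \<beta>\<nu>) = sets (\<mu> \<Otimes>\<^sub>M \<nu>)"
    by (auto intro!: sets_pair_measure_cong simp: s sets)
  have dup: "(\<lambda>x. (x, x)) \<in> \<alpha> \<rightarrow>\<^sub>M \<mu> \<Otimes>\<^sub>M \<nu>"
    using sp2(1) measurable_cong_sets by (simp cong: measurable_cong_sets)
  define \<pi> where "\<pi> = add_measure (distr \<alpha> (\<mu> \<Otimes>\<^sub>M \<nu>) (\<lambda>x. (x, x)))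
      (scale_measure (inverse (ennreal t)) (\<beta>\<mu> \<Otimes>\<^sub>M \<beta>\<nu>))"
  have em: "emeasure \<pi> C = emeasure \<alpha> ((\<lambda>x. (x, x)) -` C \<inter> space \<mu>) +
      inverse (ennreal t) * emeasure (\<beta>\<mu> \<Otimes>\<^sub>M \<beta>\<nu>) C" if "C \<in> sets (\<mu> \<Otimes>\<^sub>M \<nu>)" for C
    unfolding \<pi>_def using that dup sp2(2)
    by (subst emeasure_add_measure) (simp_all add: emeasure_distr sp)
  \<comment> \<open>For \<open>t = 0\<close> the factor is \<open>inverse 0 = \<top>\<close>, but then the remainders vanish and \<open>\<top> * 0 = 0\<close>.\<close>
  have cancel: "inverse (ennreal t) * (b * ennreal t) = b" if "b \<le> ennreal t" for b
  proof (cases "t = 0")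
    case False
    then have "inverse (ennreal t) * ennreal t = 1"
      using t0 by (simp add: inverse_ennreal flip: ennreal_mult)
    then show ?thesis by (metis mult.left_commute mult.right_neutral)
  qed (use that in simp)
  have spp[simp]: "space \<pi> = space \<mu> \<times> space \<mu>" "sets \<pi> = sets (\<mu> \<Otimes>\<^sub>M \<nu>)"
    by (simp_all add: \<pi>_def space_pair_measure sp)
  have marg1: "emeasure \<pi> (A \<times> space \<mu>) = emeasure \<mu> A" if A: "A \<in> sets \<mu>" for A
  proof -
    have "(\<lambda>x. (x, x)) -` (A \<times> space \<mu>) \<inter> space \<mu> = A" using sets.sets_into_space[OF A] by auto
    moreover have "emeasure (\<beta>\<mu> \<Otimes>\<^sub>M \<beta>\<nu>) (A \<times> space \<mu>) = emeasure \<beta>\<mu> A * ennreal t"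
      using A by (subst \<beta>\<nu>.emeasure_pair_measure_Times) (auto simp: mass)
    moreover have "emeasure \<beta>\<mu> A \<le> ennreal t"
      using emeasure_space[of \<beta>\<mu> A] by (simp add: mass)
    moreover have "A \<times> space \<mu> \<in> sets (\<mu> \<Otimes>\<^sub>M \<nu>)" using A sets by auto
    ultimately show ?thesis
      using \<alpha>\<mu>[OF A] by (simp add: em cancel) (simp add: b\<mu>[OF A] add_diff_inverse_ennreal)
  qed
  have marg2: "emeasure \<pi> (space \<mu> \<times> A) = emeasure \<nu> A" if A: "A \<in> sets \<mu>" for A
  proof -
    have "(\<lambda>x. (x, x)) -` (space \<mu> \<times> A) \<inter> space \<mu> = A" using sets.sets_into_space[OF A] by auto
    moreover have "emeasure (\<beta>\<mu> \<Otimes>\<^sub>M \<beta>\<nu>) (space \<mu> \<times> A) = emeasure \<beta>\<nu> A * ennreal t"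
      using A by (subst \<beta>\<nu>.emeasure_pair_measure_Times) (auto simp: mass mult.commute)
    moreover have "emeasure \<beta>\<nu> A \<le> ennreal t"
      using emeasure_space[of \<beta>\<nu> A] by (simp add: mass)
    moreover have "space \<mu> \<times> A \<in> sets (\<mu> \<Otimes>\<^sub>M \<nu>)" using A sets by auto
    ultimately show ?thesis
      using \<alpha>\<nu>[OF A] by (simp add: em cancel) (simp add: b\<nu>[OF A] add_diff_inverse_ennreal)
  qed
  have "\<pi> \<in> couplings \<mu> \<nu>"
    unfolding couplings_def
  proof (intro CollectI conjI)
    show "prob_space \<pi>"
      by (rule prob_spaceI) (simp add: marg1 \<mu>.emeasure_space_1)
    show "sets \<pi> = sets (\<mu> \<Otimes>\<^sub>M \<nu>)" by simp
    have m[measurable]: "fst \<in> \<pi> \<rightarrow>\<^sub>M \<mu>" "snd \<in> \<pi> \<rightarrow>\<^sub>M \<nu>"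
      using measurable_cong_sets[OF spp(2) refl] by auto
    show "distr \<pi> \<mu> fst = \<mu>"
    proof (rule measure_eqI)
      fix A assume "A \<in> sets (distr \<pi> \<mu> fst)"
      then have A: "A \<in> sets \<mu>" by simp
      have "fst -` A \<inter> space \<pi> = A \<times> space \<mu>" using sets.sets_into_space[OF A] by auto
      then show "emeasure (distr \<pi> \<mu> fst) A = emeasure \<mu> A"
        using A m by (simp add: emeasure_distr marg1)
    qed simp
    show "distr \<pi> \<nu> snd = \<nu>"
    proof (rule measure_eqI)
      fix A assume "A \<in> sets (distr \<pi> \<nu> snd)"
      then have A: "A \<in> sets \<mu>" "A \<in> sets \<nu>" by (simp_all add: sets)
      have "snd -` A \<inter> space \<pi> = space \<mu> \<times> A" using sets.sets_into_space[OF A(1)] by auto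
      then show "emeasure (distr \<pi> \<nu> snd) A = emeasure \<nu> A"
        using A m by (simp add: emeasure_distr marg2)
    qed simp
  qed
  moreover have "emeasure \<pi> ?D \<le> ennreal (tv_dist \<mu> \<nu>)"
  proof -
    have "emeasure \<pi> ?D = inverse (ennreal t) * emeasure (\<beta>\<mu> \<Otimes>\<^sub>M \<beta>\<nu>) ?D"
      using em[OF diag] by (simp add: vimage_def)
    also have "\<dots> \<le> inverse (ennreal t) * emeasure (\<beta>\<mu> \<Otimes>\<^sub>M \<beta>\<nu>) (space \<mu> \<times> space \<mu>)"
      by (intro mult_left_mono emeasure_mono) (auto simp: space_pair_measure sp)
    also have "\<dots> = inverse (ennreal t) * (ennreal t * ennreal t)"
      by (subst \<beta>\<nu>.emeasure_pair_measure_Times) (auto simp: mass)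
    also have "\<dots> = ennreal t" by (simp add: cancel)
    also have "\<dots> \<le> ennreal (tv_dist \<mu> \<nu>)" using \<alpha>tv by (intro ennreal_leI) (simp add: t_def)
    finally show ?thesis .
  qed
  ultimately show ?thesis by (rule that)
qed

lemma wasserstein2_le_diameter_tv_dist:
  fixes K :: "'a::{metric_space, second_countable_topology} set"
  assumes "bounded K" and \<mu>: "law_on K \<mu>" and \<nu>: "law_on K \<nu>"
  shows "wasserstein2 \<mu> \<nu> \<le> ennreal (diameter K * sqrt (tv_dist \<mu> \<nu>))"
proof -
  have p: "prob_space \<mu>" "prob_space \<nu>" and s: "sets \<mu> = sets (restrict_space borel K)"
    "sets \<nu> = sets (restrict_space borel K)"
    using \<mu> \<nu> by (auto simp: law_on_def)
  have spc: "space \<mu> = K" "space \<nu> = K" using s[THEN sets_eq_imp_space_eq] by (auto simp: space_restrict_space)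
  have proj: "fst \<in> \<mu> \<Otimes>\<^sub>M \<nu> \<rightarrow>\<^sub>M borel" "snd \<in> \<mu> \<Otimes>\<^sub>M \<nu> \<rightarrow>\<^sub>M borel"
  proof -
    have i: "(\<lambda>x. x) \<in> \<mu> \<rightarrow>\<^sub>M borel" "(\<lambda>x. x) \<in> \<nu> \<rightarrow>\<^sub>M borel"
      by (simp_all add: s measurable_restrict_space1 cong: measurable_cong_sets)
    show "fst \<in> \<mu> \<Otimes>\<^sub>M \<nu> \<rightarrow>\<^sub>M borel" "snd \<in> \<mu> \<Otimes>\<^sub>M \<nu> \<rightarrow>\<^sub>M borel"
      using measurable_compose[OF measurable_fst i(1)] measurable_compose[OF measurable_snd i(2)]
      by auto
  qed
  let ?D = "{z \<in> space (\<mu> \<Otimes>\<^sub>M \<nu>). fst z \<noteq> snd z}"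
  \<comment> \<open>The distance of the two coordinates is measurable, and the diagonal is its zero set.\<close>
  have "?D = {z \<in> space (\<mu> \<Otimes>\<^sub>M \<nu>). dist (fst z) (snd z) \<noteq> 0}" by auto
  also have "\<dots> \<in> sets (\<mu> \<Otimes>\<^sub>M \<nu>)" using proj by measurable
  finally have D: "?D \<in> sets (\<mu> \<Otimes>\<^sub>M \<nu>)" .
  obtain \<pi> where \<pi>: "\<pi> \<in> couplings \<mu> \<nu>" and le: "emeasure \<pi> ?D \<le> ennreal (tv_dist \<mu> \<nu>)"
    using ex_coupling_off_diagonal[OF p _ D] s by auto
  have s\<pi>: "sets \<pi> = sets (\<mu> \<Otimes>\<^sub>M \<nu>)" using \<pi> by (simp add: couplings_def)
  define L where "L = diameter K"
  have L: "0 \<le> L" using diameter_ge_0[OF assms(1)] by (simp add: L_def)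
  have tv: "0 \<le> tv_dist \<mu> \<nu>" by (rule tv_dist_nonneg[OF p])
  let ?c = "INF \<pi>\<in>couplings \<mu> \<nu>. \<integral>\<^sup>+z. ennreal ((dist (fst z) (snd z))\<^sup>2) \<partial>\<pi>"
  have "?c \<le> (\<integral>\<^sup>+z. ennreal ((dist (fst z) (snd z))\<^sup>2) \<partial>\<pi>)"
    using \<pi> by (rule INF_lower)
  also have "\<dots> \<le> (\<integral>\<^sup>+z. ennreal (L\<^sup>2) * indicator ?D z \<partial>\<pi>)"
  proof (rule nn_integral_mono)
    fix z assume "z \<in> space \<pi>"
    then have z: "z \<in> space (\<mu> \<Otimes>\<^sub>M \<nu>)" using sets_eq_imp_space_eq[OF s\<pi>] by simp
    then have "fst z \<in> K" "snd z \<in> K" by (auto simp: space_pair_measure spc)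
    then have "(dist (fst z) (snd z))\<^sup>2 \<le> L\<^sup>2"
      unfolding L_def by (intro power_mono diameter_bounded_bound assms) auto
    then show "ennreal ((dist (fst z) (snd z))\<^sup>2) \<le> ennreal (L\<^sup>2) * indicator ?D z"
      using z by (auto simp: indicator_def intro: ennreal_leI)
  qed
  also have "\<dots> = ennreal (L\<^sup>2) * emeasure \<pi> ?D"
    using D s\<pi> by (subst nn_integral_cmult_indicator) auto
  also have "\<dots> \<le> ennreal (L\<^sup>2) * ennreal (tv_dist \<mu> \<nu>)" by (intro mult_left_mono le) simp
  also have "\<dots> = ennreal (L\<^sup>2 * tv_dist \<mu> \<nu>)" using tv by (simp add: ennreal_mult)
  finally have c: "?c \<le> ennreal (L\<^sup>2 * tv_dist \<mu> \<nu>)" .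
  then have "?c \<noteq> top" using le_less_trans[OF c ennreal_less_top] by (rule_tac less_imp_neq)
  then have "wasserstein2 \<mu> \<nu> = ennreal (sqrt (enn2real ?c))"
    unfolding wasserstein2_def Let_def by (rule if_not_P)
  also have "\<dots> \<le> ennreal (sqrt (L\<^sup>2 * tv_dist \<mu> \<nu>))"
    using enn2real_mono[OF c] tv by (intro ennreal_leI real_sqrt_le_mono) simp
  also have "\<dots> = ennreal (L * sqrt (tv_dist \<mu> \<nu>))"
    using L by (simp add: real_sqrt_mult)
  finally show ?thesis by (simp add: L_def)
qed

section \<open>Chains with a uniform minorization\<close>

text \<open>Each step loses the mass \<open>\<epsilon>\<close> on which all the laws \<open>P x\<close> agree: subtracting the constant
  \<open>\<epsilon> \<eta> B\<close> from \<open>x \<mapsto> P x B\<close> leaves a function that is nonnegative by the minorization for \<open>B\<close> and at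
  most \<open>1 - \<epsilon>\<close> by the minorization for the complement of \<open>B\<close>.\<close>

lemma tv_dist_bind_le:
  assumes \<mu>: "\<mu> \<in> space (prob_algebra S)" and \<nu>: "\<nu> \<in> space (prob_algebra S)"
    and P: "P \<in> S \<rightarrow>\<^sub>M prob_algebra S" and \<eta>: "\<eta> \<in> space (prob_algebra S)"
    and "0 \<le> \<epsilon>" "\<epsilon> \<le> 1"
    and minor: "\<And>x A. x \<in> space S \<Longrightarrow> A \<in> sets S \<Longrightarrow> \<epsilon> * measure \<eta> A \<le> measure (P x) A"
  shows "tv_dist (bind \<mu> P) (bind \<nu> P) \<le> (1 - \<epsilon>) * tv_dist \<mu> \<nu>"
proof -
  have one_sided: "measure (bind \<mu> P) B \<le> measure (bind \<nu> P) B + (1 - \<epsilon>) * tv_dist \<mu> \<nu>"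
    if \<mu>: "\<mu> \<in> space (prob_algebra S)" and \<nu>: "\<nu> \<in> space (prob_algebra S)"
      and B[measurable]: "B \<in> sets S" for \<mu> \<nu> B
  proof -
    interpret \<mu>: prob_space \<mu> using \<mu> by (simp add: space_prob_algebra)
    interpret \<nu>: prob_space \<nu> using \<nu> by (simp add: space_prob_algebra)
    interpret \<mu>P: prob_space "bind \<mu> P" by (rule prob_space_bind'[OF \<mu> P])
    interpret \<nu>P: prob_space "bind \<nu> P" by (rule prob_space_bind'[OF \<nu> P])
    interpret \<eta>: prob_space \<eta> using \<eta> by (simp add: space_prob_algebra)
    have sets[measurable_cong]: "sets \<mu> = sets S" "sets \<nu> = sets S" "sets \<eta> = sets S"
      using \<mu> \<nu> \<eta> by (auto simp: space_prob_algebra)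
    note sp = sets[THEN sets_eq_imp_space_eq]
    define h where "h x = measure (P x) B - \<epsilon> * measure \<eta> B" for x
    have h: "0 \<le> h x \<and> h x \<le> 1 - \<epsilon>" if x: "x \<in> space S" for x
    proof -
      have Px: "prob_space (P x)" "sets (P x) = sets S"
        using measurable_space[OF P x] by (auto simp: space_prob_algebra)
      interpret Px: prob_space "P x" by (rule Px)
      have "\<epsilon> * measure \<eta> (space S - B) \<le> measure (P x) (space S - B)"
        by (intro minor x) simp
      moreover have "measure \<eta> (space S - B) = 1 - measure \<eta> B"
        using \<eta>.prob_compl[of B] sp sets by simp
      moreover have "measure (P x) (space S - B) = 1 - measure (P x) B"
        using Px.prob_compl[of B] Px sets_eq_imp_space_eq[OF Px(2)] by simp
      ultimately show ?thesis
        using minor[OF x B] by (auto simp: h_def algebra_simps)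
    qed
    have "h \<in> borel_measurable S"
      unfolding h_def using measurable_prob_algebraD[OF P] by measurable
    then have hm: "h \<in> borel_measurable \<mu>" "h \<in> borel_measurable \<nu>" by simp_all
    have dec: "emeasure (bind M P) B = ennreal (\<epsilon> * measure \<eta> B) + (\<integral>\<^sup>+x. ennreal (h x) \<partial>M)"
      if M: "M \<in> space (prob_algebra S)" and hM: "h \<in> borel_measurable M" for M
    proof -
      interpret M: prob_space M using M by (simp add: space_prob_algebra)
      have spM: "space M = space S" using M by (auto simp: space_prob_algebra dest: sets_eq_imp_space_eq)
      have "emeasure (bind M P) B = (\<integral>\<^sup>+x. emeasure (P x) B \<partial>M)"
        by (rule emeasure_bind_prob_algebra[OF M P B])
      also have "\<dots> = (\<integral>\<^sup>+x. ennreal (\<epsilon> * measure \<eta> B) + ennreal (h x) \<partial>M)"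
      proof (rule nn_integral_cong)
        fix x assume "x \<in> space M"
        then have x: "x \<in> space S" using spM by simp
        interpret Px: prob_space "P x"
          using measurable_space[OF P x] by (auto simp: space_prob_algebra)
        show "emeasure (P x) B = ennreal (\<epsilon> * measure \<eta> B) + ennreal (h x)"
          using h[OF x] \<open>0 \<le> \<epsilon>\<close>
          by (simp add: Px.emeasure_eq_measure h_def flip: ennreal_plus)
      qed
      also have "\<dots> = ennreal (\<epsilon> * measure \<eta> B) + (\<integral>\<^sup>+x. ennreal (h x) \<partial>M)"
        using hM by (subst nn_integral_add) (auto simp: M.emeasure_space_1)
      finally show ?thesis .
    qed
    have "emeasure (bind \<mu> P) B \<le> emeasure (bind \<nu> P) B + ennreal ((1 - \<epsilon>) * tv_dist \<mu> \<nu>)"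
      unfolding dec[OF \<mu> hm(1)] dec[OF \<nu> hm(2)] add.assoc
      by (intro add_left_mono nn_integral_le_add_tv_dist)
        (use h sp sets hm \<open>\<epsilon> \<le> 1\<close> in \<open>auto intro: \<mu>.prob_space_axioms \<nu>.prob_space_axioms\<close>)
    then show ?thesis
      using \<open>\<epsilon> \<le> 1\<close> tv_dist_nonneg[OF \<mu>.prob_space_axioms \<nu>.prob_space_axioms]
      by (simp add: \<mu>P.emeasure_eq_measure \<nu>P.emeasure_eq_measure flip: ennreal_plus)
  qed
  have sets: "sets \<mu> = sets \<nu>" using \<mu> \<nu> by (simp add: space_prob_algebra)
  show ?thesis
  proof (rule tv_dist_least)
    fix B assume "B \<in> sets (bind \<mu> P)"
    then have B: "B \<in> sets S" by (simp add: sets_bind'[OF \<mu> P])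
    show "\<bar>measure (bind \<mu> P) B - measure (bind \<nu> P) B\<bar> \<le> (1 - \<epsilon>) * tv_dist \<mu> \<nu>"
      using one_sided[OF \<mu> \<nu> B] one_sided[OF \<nu> \<mu> B] tv_dist_commute[OF sets] by auto
  qed
qed

lemma law_on_iff: "law_on K \<mu> \<longleftrightarrow> \<mu> \<in> space (prob_algebra (restrict_space borel K))"
  by (auto simp: law_on_def space_prob_algebra)

lemma step_law_0: "step_law P 0 \<rho> = \<rho>"
  and step_law_Suc: "step_law P (Suc m) \<rho> = bind (step_law P m \<rho>) P"
  by (simp_all add: step_law_def)

lemma step_law_in_prob_algebra:
  assumes "\<rho> \<in> space (prob_algebra S)" and "P \<in> S \<rightarrow>\<^sub>M prob_algebra S"
  shows "step_law P m \<rho> \<in> space (prob_algebra S)"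
proof (induction m)
  case (Suc m)
  then show ?case
    using prob_space_bind'[OF Suc assms(2)] sets_bind'[OF Suc assms(2)]
    by (simp add: step_law_Suc space_prob_algebra)
qed (simp add: step_law_0 assms)

lemma tv_dist_step_law_le:
  assumes \<rho>: "\<rho> \<in> space (prob_algebra S)" and \<nu>: "\<nu> \<in> space (prob_algebra S)"
    and P: "P \<in> S \<rightarrow>\<^sub>M prob_algebra S" and \<eta>: "\<eta> \<in> space (prob_algebra S)"
    and \<epsilon>: "0 \<le> \<epsilon>" "\<epsilon> \<le> 1"
    and minor: "\<And>x A. x \<in> space S \<Longrightarrow> A \<in> sets S \<Longrightarrow> \<epsilon> * measure \<eta> A \<le> measure (P x) A"
    and inv: "invariant_law P \<nu>"
  shows "tv_dist (step_law P m \<rho>) \<nu> \<le> (1 - \<epsilon>) ^ m * tv_dist \<rho> \<nu>"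
proof (induction m)
  case (Suc m)
  have "tv_dist (step_law P (Suc m) \<rho>) \<nu> = tv_dist (bind (step_law P m \<rho>) P) (bind \<nu> P)"
    using inv by (simp add: step_law_Suc invariant_law_def)
  also have "\<dots> \<le> (1 - \<epsilon>) * tv_dist (step_law P m \<rho>) \<nu>"
    by (rule tv_dist_bind_le[OF step_law_in_prob_algebra[OF \<rho> P] \<nu> P \<eta> \<epsilon> minor])
  also have "\<dots> \<le> (1 - \<epsilon>) * ((1 - \<epsilon>) ^ m * tv_dist \<rho> \<nu>)"
    using Suc \<epsilon> by (intro mult_left_mono) auto
  finally show ?case by (simp add: mult.assoc)
qed (simp add: step_law_0)

lemma invariant_law_unique:
  assumes \<mu>: "\<mu> \<in> space (prob_algebra S)" and \<nu>: "\<nu> \<in> space (prob_algebra S)"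
    and P: "P \<in> S \<rightarrow>\<^sub>M prob_algebra S" and \<eta>: "\<eta> \<in> space (prob_algebra S)"
    and \<epsilon>: "0 < \<epsilon>" "\<epsilon> \<le> 1"
    and minor: "\<And>x A. x \<in> space S \<Longrightarrow> A \<in> sets S \<Longrightarrow> \<epsilon> * measure \<eta> A \<le> measure (P x) A"
    and inv: "invariant_law P \<mu>" "invariant_law P \<nu>"
  shows "\<mu> = \<nu>"
proof -
  have p: "prob_space \<mu>" "prob_space \<nu>" "sets \<mu> = sets \<nu>" using \<mu> \<nu> by (auto simp: space_prob_algebra)
  have "tv_dist \<mu> \<nu> \<le> (1 - \<epsilon>) * tv_dist \<mu> \<nu>"
    using tv_dist_bind_le[OF \<mu> \<nu> P \<eta> less_imp_le[OF \<epsilon>(1)] \<epsilon>(2) minor]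
    unfolding inv[unfolded invariant_law_def] .
  then have "\<epsilon> * tv_dist \<mu> \<nu> \<le> 0" by (simp add: algebra_simps)
  then have "tv_dist \<mu> \<nu> = 0"
    using \<epsilon>(1) tv_dist_nonneg[OF p(1,2)] by (simp add: mult_le_0_iff)
  then show ?thesis by (rule eq_measure_if_tv_dist_eq_0[OF p])
qed

text \<open>Reversibility applied to the whole space and \<open>B\<close>: the flow into \<open>B\<close> equals the flow out of
  \<open>B\<close>, which is the mass of \<open>B\<close>.\<close>

lemma reversible_imp_invariant:
  assumes \<mu>: "\<mu> \<in> space (prob_algebra S)" and P: "P \<in> S \<rightarrow>\<^sub>M prob_algebra S"
    and rev: "reversible_law P \<mu>"
  shows "invariant_law P \<mu>"
  unfolding invariant_law_def
proof (rule measure_eqI)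
  have s: "sets \<mu> = sets S" using \<mu> by (simp add: space_prob_algebra)
  note sp = sets_eq_imp_space_eq[OF s]
  show "sets (bind \<mu> P) = sets \<mu>" by (simp add: sets_bind'[OF \<mu> P] s)
  fix B assume "B \<in> sets (bind \<mu> P)"
  then have B: "B \<in> sets S" by (simp add: sets_bind'[OF \<mu> P])
  have "emeasure (bind \<mu> P) B = (\<integral>\<^sup>+x\<in>space \<mu>. emeasure (P x) B \<partial>\<mu>)"
    by (simp add: emeasure_bind_prob_algebra[OF \<mu> P B] cong: nn_integral_cong)
  also have "\<dots> = (\<integral>\<^sup>+x\<in>B. emeasure (P x) (space \<mu>) \<partial>\<mu>)"
    using rev B s sets.top[of \<mu>] unfolding reversible_law_def by blast
  also have "\<dots> = (\<integral>\<^sup>+x. indicator B x \<partial>\<mu>)"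
  proof (rule nn_integral_cong)
    fix x assume "x \<in> space \<mu>"
    then have "prob_space (P x)" "sets (P x) = sets S"
      using measurable_space[OF P, of x] sp by (auto simp: space_prob_algebra)
    then have "emeasure (P x) (space \<mu>) = 1"
      using prob_space.emeasure_space_1 sp sets_eq_imp_space_eq by metis
    then show "emeasure (P x) (space \<mu>) * indicator B x = indicator B x" by simp
  qed
  also have "\<dots> = emeasure \<mu> B" using B s by simp
  finally show "emeasure (bind \<mu> P) B = emeasure \<mu> B" .
qed

section \<open>The Gaussian proposal\<close>

lemma gauss_eq_prod_normal_density:
  fixes x y :: "'a::euclidean_space"
  assumes "0 < \<sigma>"
  shows "gauss \<sigma> (y - x) = (\<Prod>b\<in>Basis. normal_density (x \<bullet> b) \<sigma> (y \<bullet> b))"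
proof -
  let ?c = "2 * pi * \<sigma>\<^sup>2"
  have "0 < ?c" using assms by simp
  have "?c powr (- real DIM('a) / 2) = (?c powr (- 1 / 2)) powr real DIM('a)"
    by (simp add: powr_powr)
  also have "\<dots> = (1 / sqrt ?c) ^ DIM('a)"
    using \<open>0 < ?c\<close> by (simp add: powr_realpow powr_minus powr_half_sqrt inverse_eq_divide)
  finally have const: "?c powr (- real DIM('a) / 2) = (1 / sqrt ?c) ^ DIM('a)" .
  have "(norm (y - x))\<^sup>2 = (\<Sum>b\<in>Basis. (y \<bullet> b - x \<bullet> b)\<^sup>2)"
    by (subst power2_norm_eq_inner, subst euclidean_inner)
      (simp add: power2_eq_square inner_diff_left)
  then have "exp (- (norm (y - x))\<^sup>2 / (2 * \<sigma>\<^sup>2)) =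
      (\<Prod>b\<in>Basis. exp (- (y \<bullet> b - x \<bullet> b)\<^sup>2 / (2 * \<sigma>\<^sup>2)))"
    by (simp add: exp_sum sum_negf sum_divide_distrib flip: exp_sum)
  then show ?thesis
    unfolding gauss_def normal_density_def prod.distrib prod_constant const by simp
qed

lemma gauss_nonneg: "0 \<le> gauss \<sigma> z"
  by (simp add: gauss_def)

lemma gauss_commute: "gauss \<sigma> (y - x) = gauss \<sigma> (x - y)"
  by (simp add: gauss_def norm_minus_commute)

lemma measurable_gauss[measurable]: "gauss \<sigma> \<in> borel_measurable borel"
  unfolding gauss_def by measurable

lemma nn_integral_gauss:
  fixes x :: "'a::euclidean_space"
  assumes "0 < \<sigma>"
  shows "(\<integral>\<^sup>+y. ennreal (gauss \<sigma> (y - x)) \<partial>lborel) = 1"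
proof -
  have "(\<integral>\<^sup>+y. ennreal (gauss \<sigma> (y - x)) \<partial>lborel) =
    (\<integral>\<^sup>+y. (\<Prod>b\<in>Basis. ennreal (normal_density (x \<bullet> b) \<sigma> (y \<bullet> b))) \<partial>lborel)"
    by (simp add: gauss_eq_prod_normal_density[OF assms] prod_ennreal)
  also have "\<dots> = (\<Prod>b\<in>Basis. (\<integral>\<^sup>+t. ennreal (normal_density (x \<bullet> b) \<sigma> t) \<partial>lborel))"
    by (rule nn_integral_lborel_prod) auto
  also have "\<dots> = 1"
    using assms by (simp add: nn_integral_eq_integral)
  finally show ?thesis .
qed

section \<open>The Metropolis kernel on a compact set\<close>

text \<open>Compactness together with continuity makes the normalizing constant finite, and the positive
  volume makes it nonzero.\<close>

locale metropolis =
  fixes K :: "'a::euclidean_space set" and g \<Psi> :: "'a \<Rightarrow> real" and \<kappa> \<sigma> :: real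
  assumes compact: "compact K" and pos_vol: "0 < measure lborel K"
    and cont_g: "continuous_on K g" and cont_\<Psi>: "continuous_on K \<Psi>"
    and \<sigma>_pos: "0 < \<sigma>"
begin

abbreviation "P \<equiv> mh_kernel K g \<Psi> \<kappa> \<sigma>"
abbreviation "\<nu> \<equiv> target K g \<Psi> \<kappa>"
abbreviation "S \<equiv> restrict_space borel K"

text \<open>The functions \<open>g\<close> and \<open>\<Psi>\<close> are controlled on \<open>K\<close> only. Setting the energy to \<open>0\<close> outside
  makes it Borel measurable on the whole space, so that the transition density below is jointly
  measurable there and Tonelli's theorem applies to Lebesgue measure.\<close>

definition energy :: "'a \<Rightarrow> real" where
  "energy x = (if x \<in> K then g x + \<kappa> / 2 * \<Psi> x else 0)"

definition accepted_density :: "'a \<Rightarrow> 'a \<Rightarrow> real" where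
  "accepted_density x y = gauss \<sigma> (y - x) * (indicator K y * min 1 (exp (energy x - energy y)))"

lemma K_borel[measurable]: "K \<in> sets borel"
  using compact by (rule borel_compact)

lemma K_ne: "K \<noteq> {}"
  using pos_vol by auto

lemma space_S: "space S = K"
  by (simp add: space_restrict_space)

lemma sets_S: "A \<in> sets S \<longleftrightarrow> A \<in> sets borel \<and> A \<subseteq> K"
  by (subst sets_restrict_space_iff) auto

lemma K_vol: "emeasure lborel K = ennreal (measure lborel K)"
  using emeasure_compact_finite[OF compact] by (simp add: emeasure_eq_ennreal_measure)

lemma measurable_energy[measurable]: "energy \<in> borel_measurable borel"
proof -
  have "continuous_on K (\<lambda>x. g x + \<kappa> / 2 * \<Psi> x)"
    by (intro continuous_intros cont_g cont_\<Psi>)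
  from borel_measurable_continuous_on_indicator[OF K_borel this]
  show ?thesis
    by (rule measurable_cong[THEN iffD1, rotated]) (simp add: energy_def indicator_def)
qed

lemma accepted_density_nonneg: "0 \<le> accepted_density x y"
  by (simp add: accepted_density_def gauss_nonneg)

lemma accepted_density_le_gauss: "accepted_density x y \<le> gauss \<sigma> (y - x)"
  unfolding accepted_density_def
  by (rule mult_left_le) (auto simp: gauss_nonneg indicator_def)

lemma measurable_accepted_density[measurable]:
  "(\<lambda>(x, y). accepted_density x y) \<in> borel_measurable (borel \<Otimes>\<^sub>M borel)"
  unfolding accepted_density_def by measurable

lemma gauss_accept_eq:
  assumes "x \<in> K"
  shows "gauss \<sigma> (y - x) * accept K g \<Psi> \<kappa> x y = accepted_density x y"
proof (cases "y \<in> K")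
  case True
  have "g x - g y - \<kappa> / 2 * (\<Psi> y - \<Psi> x) = energy x - energy y"
    using assms True by (simp add: energy_def field_simps)
  then show ?thesis using True by (simp add: accepted_density_def accept_def)
qed (simp add: accepted_density_def accept_def)

lemma nn_integral_accepted_density_le_1: "(\<integral>\<^sup>+y. ennreal (accepted_density x y) \<partial>lborel) \<le> 1"
  using nn_integral_mono[of lborel "\<lambda>y. ennreal (accepted_density x y)" "\<lambda>y. ennreal (gauss \<sigma> (y - x))"]
  by (simp add: nn_integral_gauss[OF \<sigma>_pos] accepted_density_le_gauss ennreal_leI)

text \<open>The rejection probability is a real number defined by a Bochner integral. Its embedding into
  the extended nonnegative reals loses nothing, because the accepted mass is at most \<open>1\<close>.\<close>

lemma ennreal_reject:
  assumes "x \<in> K"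
  shows "ennreal (reject K g \<Psi> \<kappa> \<sigma> x) = 1 - (\<integral>\<^sup>+y. ennreal (accepted_density x y) \<partial>lborel)"
proof -
  let ?I = "\<integral>\<^sup>+y. ennreal (accepted_density x y) \<partial>lborel"
  have "(LINT y|lborel. accepted_density x y) = enn2real ?I"
    by (rule integral_eq_nn_integral) (auto simp: accepted_density_nonneg)
  then have "reject K g \<Psi> \<kappa> \<sigma> x = 1 - enn2real ?I"
    unfolding reject_def gauss_accept_eq[OF assms] by (rule arg_cong)
  then have "ennreal (reject K g \<Psi> \<kappa> \<sigma> x) = 1 - ennreal (enn2real ?I)"
    by (simp add: ennreal_minus flip: ennreal_1)
  moreover have "ennreal (enn2real ?I) = ?I"
    using le_less_trans[OF nn_integral_accepted_density_le_1 ennreal_one_less_top] by (simp add: less_top)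
  ultimately show ?thesis by simp
qed

lemma emeasure_P:
  assumes x: "x \<in> K" and A: "A \<in> sets S"
  shows "emeasure (P x) A = (\<integral>\<^sup>+y. ennreal (accepted_density x y) * indicator A y \<partial>lborel) +
    (1 - (\<integral>\<^sup>+y. ennreal (accepted_density x y) \<partial>lborel)) * indicator A x"
proof -
  have "A \<in> sets borel" using A by (simp add: sets_S)
  then show ?thesis
    unfolding emeasure_mh_kernel[OF K_borel A] gauss_accept_eq[OF x] ennreal_reject[OF x]
    by (simp add: emeasure_density)
qed

lemma P_kernel: "P \<in> S \<rightarrow>\<^sub>M prob_algebra S"
proof (rule measurable_prob_algebraI)
  show prob: "prob_space (P x)" if "x \<in> space S" for x
  proof (rule prob_spaceI)
    have x: "x \<in> K" using that by (simp add: space_S)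
    have "space (P x) = K" by (simp add: sets_eq_imp_space_eq[OF sets_mh_kernel] space_S)
    moreover have "K \<in> sets S" by (simp add: sets_S)
    moreover have "(\<integral>\<^sup>+y. ennreal (accepted_density x y) * indicator K y \<partial>lborel) =
        (\<integral>\<^sup>+y. ennreal (accepted_density x y) \<partial>lborel)"
      by (intro nn_integral_cong) (auto simp: accepted_density_def indicator_def)
    ultimately show "emeasure (P x) (space (P x)) = 1"
      using x nn_integral_accepted_density_le_1[of x] by (simp add: emeasure_P add_diff_inverse_ennreal)
  qed
  show "P \<in> S \<rightarrow>\<^sub>M subprob_algebra S"
  proof (rule measurable_subprob_algebra)
    fix A assume A: "A \<in> sets S"
    then have [measurable]: "A \<in> sets borel" by (simp add: sets_S)
    have "(\<lambda>x. (\<integral>\<^sup>+y. ennreal (accepted_density x y) * indicator A y \<partial>lborel) +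
      (1 - (\<integral>\<^sup>+y. ennreal (accepted_density x y) \<partial>lborel)) * indicator A x) \<in> borel_measurable borel"
      by measurable
    from measurable_restrict_space1[OF this, of K]
    show "(\<lambda>x. emeasure (P x) A) \<in> borel_measurable S"
      by (rule measurable_cong[THEN iffD1, rotated]) (simp add: emeasure_P A space_S)
  next
    show "subprob_space (P x)" if "x \<in> space S" for x
      by (rule prob_space_imp_subprob_space[OF prob[OF that]])
  qed (rule sets_mh_kernel)
qed

text \<open>Rejection only adds mass, and on \<open>K\<close> the density of the accepted moves is bounded below: the
  Gaussian factor is at least its value at distance \<^term>\<open>diameter K\<close>, and the acceptance
  probability is at least \<open>exp (- c)\<close>.\<close>

lemma measure_P_ge:
  assumes x: "x \<in> K" and A: "A \<in> sets S" and "\<And>y. y \<in> K \<Longrightarrow> energy y - energy x \<le> c" and "0 \<le> c"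
  shows "(2 * pi * \<sigma>\<^sup>2) powr (- real DIM('a) / 2) * exp (- (diameter K)\<^sup>2 / (2 * \<sigma>\<^sup>2) - c) *
    measure lborel A \<le> measure (P x) A"
proof -
  let ?m = "(2 * pi * \<sigma>\<^sup>2) powr (- real DIM('a) / 2) * exp (- (diameter K)\<^sup>2 / (2 * \<sigma>\<^sup>2) - c)"
  have AK: "A \<in> sets borel" "A \<subseteq> K" using A by (auto simp: sets_S)
  interpret Px: prob_space "P x"
    using measurable_space[OF P_kernel, of x] x by (auto simp: space_prob_algebra space_S)
  have ge: "?m \<le> accepted_density x y" if y: "y \<in> A" for y
  proof -
    have yK: "y \<in> K" using y AK by auto
    have "norm (y - x) \<le> diameter K"
      using diameter_bounded_bound[OF compact_imp_bounded[OF compact] yK x] by (simp add: dist_norm)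
    then have "exp (- (diameter K)\<^sup>2 / (2 * \<sigma>\<^sup>2)) \<le> exp (- (norm (y - x))\<^sup>2 / (2 * \<sigma>\<^sup>2))"
      using \<sigma>_pos by (auto intro!: divide_right_mono power_mono)
    moreover have "exp (- c) \<le> min 1 (exp (energy x - energy y))"
      using assms(3)[OF yK] \<open>0 \<le> c\<close> by auto
    ultimately have "exp (- (diameter K)\<^sup>2 / (2 * \<sigma>\<^sup>2)) * exp (- c) \<le>
        exp (- (norm (y - x))\<^sup>2 / (2 * \<sigma>\<^sup>2)) * min 1 (exp (energy x - energy y))"
      by (rule mult_mono) auto
    from mult_left_mono[OF this, of "(2 * pi * \<sigma>\<^sup>2) powr (- real DIM('a) / 2)"] show ?thesis
      unfolding exp_add[symmetric] using yK by (simp add: accepted_density_def gauss_def mult.assoc)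
  qed
  have "emeasure lborel A \<le> emeasure lborel K" using AK by (intro emeasure_mono) auto
  also have "\<dots> < top" using K_vol by simp
  finally have "emeasure lborel A = ennreal (measure lborel A)"
    by (simp add: emeasure_eq_ennreal_measure less_top)
  then have "ennreal (?m * measure lborel A) = ennreal ?m * emeasure lborel A"
    by (simp add: ennreal_mult)
  also have "\<dots> = (\<integral>\<^sup>+y. ennreal ?m * indicator A y \<partial>lborel)"
    using AK by (simp add: nn_integral_cmult_indicator)
  also have "\<dots> \<le> (\<integral>\<^sup>+y. ennreal (accepted_density x y) * indicator A y \<partial>lborel)"
    by (intro nn_integral_mono) (use ge in \<open>auto simp: indicator_def intro: ennreal_leI\<close>)
  also have "\<dots> \<le> emeasure (P x) A"
    by (simp add: emeasure_P[OF x A])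
  finally show ?thesis by (simp add: Px.emeasure_eq_measure)
qed

text \<open>The Gaussian centred at a point of \<open>K\<close> has total mass \<open>1\<close> and on \<open>K\<close> is at least its value at
  distance \<^term>\<open>diameter K\<close>, so \<open>c = 0\<close> would give a product of at most \<open>1\<close>; strictness comes from the factor \<open>exp (- c)\<close>.\<close>

lemma minorizing_mass_less_1:
  assumes "0 < c"
  shows "measure lborel K * (2 * pi * \<sigma>\<^sup>2) powr (- real DIM('a) / 2) *
    exp (- (diameter K)\<^sup>2 / (2 * \<sigma>\<^sup>2) - c) < 1"
proof -
  let ?m = "(2 * pi * \<sigma>\<^sup>2) powr (- real DIM('a) / 2) * exp (- (diameter K)\<^sup>2 / (2 * \<sigma>\<^sup>2))"
  obtain x where x: "x \<in> K" using K_ne by auto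
  have "?m \<le> gauss \<sigma> (y - x)" if y: "y \<in> K" for y
  proof -
    have "norm (y - x) \<le> diameter K"
      using diameter_bounded_bound[OF compact_imp_bounded[OF compact] y x] by (simp add: dist_norm)
    then show ?thesis
      unfolding gauss_def using \<sigma>_pos
      by (intro mult_left_mono) (auto intro!: divide_right_mono power_mono)
  qed
  then have "(\<integral>\<^sup>+y. ennreal ?m * indicator K y \<partial>lborel) \<le> (\<integral>\<^sup>+y. ennreal (gauss \<sigma> (y - x)) \<partial>lborel)"
    by (intro nn_integral_mono) (auto simp: indicator_def intro: ennreal_leI)
  then have "ennreal (?m * measure lborel K) \<le> ennreal 1"
    by (simp add: nn_integral_gauss[OF \<sigma>_pos] nn_integral_cmult_indicator K_vol ennreal_mult)
  then have "?m * measure lborel K \<le> 1"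
    by (subst (asm) ennreal_le_iff) auto
  moreover have "0 < ?m * measure lborel K" using \<sigma>_pos pos_vol by simp
  moreover have "exp (- c) < 1" using assms by simp
  ultimately have "(?m * measure lborel K) * exp (- c) < 1"
    using mult_strict_left_mono[of "exp (- c)" 1 "?m * measure lborel K"] by linarith
  moreover have "exp (- (diameter K)\<^sup>2 / (2 * \<sigma>\<^sup>2) - c) =
      exp (- (diameter K)\<^sup>2 / (2 * \<sigma>\<^sup>2)) * exp (- c)"
    by (simp flip: exp_add)
  ultimately show ?thesis by (simp only: mult_ac)
qed

definition partition_const :: real where
  "partition_const = (LINT y:K|lborel. exp (- g y - \<kappa> / 2 * \<Psi> y))"

lemma nn_integral_weight:
  "(\<integral>\<^sup>+x. ennreal (exp (- energy x)) * indicator K x \<partial>lborel) = ennreal partition_const"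
  and partition_const_pos: "0 < partition_const"
proof -
  let ?f = "\<lambda>x. indicator K x * exp (- energy x)"
  have "continuous_on K (\<lambda>x. exp (- g x - \<kappa> / 2 * \<Psi> x))"
    by (intro continuous_intros cont_g cont_\<Psi>)
  from borel_integrable_compact[OF compact this]
  have int: "integrable lborel ?f"
    by (rule Bochner_Integration.integrable_cong[THEN iffD1, rotated 2]) (auto simp: energy_def indicator_def)
  have eq: "partition_const = integral\<^sup>L lborel ?f"
    unfolding partition_const_def set_lebesgue_integral_def
    by (intro Bochner_Integration.integral_cong) (auto simp: energy_def indicator_def)
  show *: "(\<integral>\<^sup>+x. ennreal (exp (- energy x)) * indicator K x \<partial>lborel) = ennreal partition_const"
    unfolding eq using nn_integral_eq_integral[OF int]
    by (simp add: mult.commute ennreal_mult'' ennreal_indicator)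
  show "0 < partition_const"
  proof (rule ccontr)
    assume "\<not> 0 < partition_const"
    then have "(\<integral>\<^sup>+x. ennreal (exp (- energy x)) * indicator K x \<partial>lborel) = 0"
      using * by (simp add: ennreal_neg)
    then have "AE x in lborel. ennreal (exp (- energy x)) * indicator K x = 0"
      by (subst (asm) nn_integral_0_iff_AE) auto
    then have "AE x in lborel. x \<notin> K"
      by eventually_elim (auto simp: indicator_def split: if_splits)
    then have "emeasure lborel K = 0"
      by (subst (asm) AE_iff_measurable[OF _ refl]) auto
    then show False using pos_vol K_vol by simp
  qed
qed

lemma target_eq: "\<nu> = density (restrict_space lborel K) (\<lambda>x. ennreal (exp (- energy x) / partition_const))"
proof -
  have "\<nu> = density (restrict_space lborel K) (\<lambda>x. ennreal (exp (- g x - \<kappa> / 2 * \<Psi> x) / partition_const))"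
    by (simp add: target_def partition_const_def)
  also have "\<dots> = density (restrict_space lborel K) (\<lambda>x. ennreal (exp (- energy x) / partition_const))"
    unfolding density_def
    by (rule arg_cong[where f = "measure_of _ _"], rule ext, rule nn_integral_cong)
      (auto simp: energy_def space_restrict_space)
  finally show ?thesis .
qed

lemma nn_integral_target:
  assumes f: "f \<in> borel_measurable S"
  shows "(\<integral>\<^sup>+x. f x \<partial>\<nu>) = (\<integral>\<^sup>+x\<in>K. ennreal (exp (- energy x) / partition_const) * f x \<partial>lborel)"
proof -
  have "sets (restrict_space lborel K) = sets S" by (simp add: sets_restrict_space)
  then have m: "borel_measurable (restrict_space lborel K) = borel_measurable S"
    by (rule measurable_cong_sets) simp
  have "(\<lambda>x. ennreal (exp (- energy x) / partition_const)) \<in> borel_measurable S"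
    by (rule measurable_restrict_space1) measurable
  then have "(\<integral>\<^sup>+x. f x \<partial>\<nu>) =
      (\<integral>\<^sup>+x. ennreal (exp (- energy x) / partition_const) * f x \<partial>restrict_space lborel K)"
    unfolding target_eq using f m by (subst nn_integral_density) auto
  also have "\<dots> = (\<integral>\<^sup>+x\<in>K. ennreal (exp (- energy x) / partition_const) * f x \<partial>lborel)"
    by (subst nn_integral_restrict_space) auto
  finally show ?thesis .
qed

lemma sets_target: "sets \<nu> = sets S"
  by (simp add: target_def sets_restrict_space)

lemma law_on_target: "law_on K \<nu>"
  unfolding law_on_def
proof
  show "sets \<nu> = sets S" by (rule sets_target)
  have "emeasure \<nu> (space \<nu>) = (\<integral>\<^sup>+x. 1 \<partial>\<nu>)" by simp
  also have "\<dots> = (\<integral>\<^sup>+x. ennreal (1 / partition_const) * (ennreal (exp (- energy x)) * indicator K x) \<partial>lborel)"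
    using partition_const_pos
    by (subst nn_integral_target)
      (auto intro!: nn_integral_cong simp: ennreal_mult[symmetric] mult.assoc[symmetric])
  also have "\<dots> = ennreal (1 / partition_const) * ennreal partition_const"
    by (subst nn_integral_cmult) (auto simp: nn_integral_weight)
  also have "\<dots> = 1"
    using partition_const_pos by (simp flip: ennreal_mult)
  finally show "prob_space \<nu>" by (rule prob_spaceI)
qed

text \<open>Both sides are the symmetric proposal density times the minimum of the two target weights.\<close>

lemma detailed_balance:
  assumes "x \<in> K" "y \<in> K"
  shows "exp (- energy x) * accepted_density x y = exp (- energy y) * accepted_density y x"
proof -
  have "exp (- energy x) * min 1 (exp (energy x - energy y)) = min (exp (- energy x)) (exp (- energy y))"
    for x y by (simp add: min_mult_distrib_left flip: exp_add)
  from this[of x y] this[of y x] show ?thesis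
    using assms by (simp add: accepted_density_def gauss_commute[of \<sigma> x y] min.commute mult.left_commute)
qed

text \<open>A double integral over accepted moves, symmetric by detailed balance, plus the rejected moves,
  which stay put and therefore charge only \<open>A \<inter> B\<close>.\<close>

lemma reversible_target: "reversible_law P \<nu>"
  unfolding reversible_law_def sets_target
proof (intro ballI)
  fix A B assume AB: "A \<in> sets S" "B \<in> sets S"
  then have [measurable]: "A \<in> sets borel" "B \<in> sets borel" and AK: "A \<subseteq> K" "B \<subseteq> K"
    by (auto simp: sets_S)
  define w where "w x = ennreal (exp (- energy x) / partition_const)" for x
  define rej where "rej x = 1 - (\<integral>\<^sup>+y. ennreal (accepted_density x y) \<partial>lborel)" for x
  have [measurable]: "w \<in> borel_measurable borel" "rej \<in> borel_measurable borel"
    unfolding w_def rej_def by measurable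
  have expand: "(\<integral>\<^sup>+x\<in>A. emeasure (P x) B \<partial>\<nu>) =
      (\<integral>\<^sup>+x. (\<integral>\<^sup>+y. w x * ennreal (accepted_density x y) * indicator A x * indicator B y \<partial>lborel) \<partial>lborel) +
      (\<integral>\<^sup>+x. w x * rej x * indicator (A \<inter> B) x \<partial>lborel)"
    if AB: "A \<in> sets S" "B \<in> sets S" for A B
  proof -
    have [measurable]: "A \<in> sets borel" "B \<in> sets borel" "A \<in> sets S" "B \<in> sets S" and AK: "A \<subseteq> K" "B \<subseteq> K"
      using AB by (auto simp: sets_S)
    have "(\<integral>\<^sup>+x\<in>A. emeasure (P x) B \<partial>\<nu>) =
        (\<integral>\<^sup>+x\<in>K. w x * (emeasure (P x) B * indicator A x) \<partial>lborel)"
      unfolding w_def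
      using measurable_emeasure_kernel[OF measurable_prob_algebraD[OF P_kernel] AB(2)]
        borel_measurable_indicator[OF AB(1)]
      by (intro nn_integral_target borel_measurable_times_ennreal)
    also have "\<dots> = (\<integral>\<^sup>+x. (\<integral>\<^sup>+y. w x * ennreal (accepted_density x y) * indicator A x * indicator B y \<partial>lborel) +
        w x * rej x * indicator (A \<inter> B) x \<partial>lborel)"
    proof (rule nn_integral_cong)
      fix x
      show "w x * (emeasure (P x) B * indicator A x) * indicator K x =
        (\<integral>\<^sup>+y. w x * ennreal (accepted_density x y) * indicator A x * indicator B y \<partial>lborel) +
        w x * rej x * indicator (A \<inter> B) x"
      proof (cases "x \<in> A")
        case True
        then have "x \<in> K" using AK by auto
        have "(\<integral>\<^sup>+y. w x * ennreal (accepted_density x y) * indicator A x * indicator B y \<partial>lborel) =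
          w x * (\<integral>\<^sup>+y. ennreal (accepted_density x y) * indicator B y \<partial>lborel)"
          using True by (subst nn_integral_cmult[symmetric]) (auto simp: mult.assoc)
        with True \<open>x \<in> K\<close> show ?thesis
          by (simp add: emeasure_P[OF \<open>x \<in> K\<close> AB(2)] rej_def distrib_left mult.assoc
              indicator_inter_arith)
      qed simp
    qed
    also have "\<dots> = (\<integral>\<^sup>+x. (\<integral>\<^sup>+y. w x * ennreal (accepted_density x y) * indicator A x * indicator B y \<partial>lborel) \<partial>lborel) +
      (\<integral>\<^sup>+x. w x * rej x * indicator (A \<inter> B) x \<partial>lborel)"
      by (rule nn_integral_add) measurable
    finally show ?thesis .
  qed
  have "(\<integral>\<^sup>+x. (\<integral>\<^sup>+y. w x * ennreal (accepted_density x y) * indicator A x * indicator B y \<partial>lborel) \<partial>lborel) =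
      (\<integral>\<^sup>+x. (\<integral>\<^sup>+y. w y * ennreal (accepted_density y x) * indicator B y * indicator A x \<partial>lborel) \<partial>lborel)"
  proof (intro nn_integral_cong)
    fix x y
    show "w x * ennreal (accepted_density x y) * indicator A x * indicator B y =
        w y * ennreal (accepted_density y x) * indicator B y * indicator A x"
    proof (cases "x \<in> A \<and> y \<in> B")
      case True
      then have "x \<in> K" "y \<in> K" using AK by auto
      from detailed_balance[OF this] have "w x * ennreal (accepted_density x y) = w y * ennreal (accepted_density y x)"
        using partition_const_pos by (simp add: w_def accepted_density_nonneg flip: ennreal_mult)
      with True show ?thesis by simp
    qed auto
  qed
  also have "\<dots> = (\<integral>\<^sup>+y. (\<integral>\<^sup>+x. w y * ennreal (accepted_density y x) * indicator B y * indicator A x \<partial>lborel) \<partial>lborel)"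
    by (rule lborel_pair.Fubini') measurable
  finally show "(\<integral>\<^sup>+x\<in>A. emeasure (P x) B \<partial>\<nu>) = (\<integral>\<^sup>+x\<in>B. emeasure (P x) A \<partial>\<nu>)"
    by (simp add: expand AB Int_commute)
qed

end

section \<open>The data of the model\<close>

lemma C2_on_imp_continuous_on:
  assumes "C2_on U g G H"
  shows "continuous_on U g"
  using assms unfolding C2_on_def gderiv_def
  by (meson continuous_at_imp_continuous_on has_derivative_continuous)

lemma cutoff_continuous_on:
  assumes "cutoff r \<phi>"
  shows "continuous_on {0..} \<phi>"
  using assms unfolding cutoff_def by (auto intro: DERIV_continuous_on)

lemma cutoff_bounds:
  assumes "cutoff r \<phi>" and "0 \<le> s"
  shows "0 \<le> \<phi> s" and "\<phi> s \<le> \<phi> (4 * r\<^sup>2)"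
proof -
  show "0 \<le> \<phi> s" using assms unfolding cutoff_def by blast
  show "\<phi> s \<le> \<phi> (4 * r\<^sup>2)"
  proof (cases "s \<le> 4 * r\<^sup>2")
    case True
    moreover have "mono_on {0..} \<phi>" using assms unfolding cutoff_def by blast
    ultimately show ?thesis using \<open>0 \<le> s\<close> by (auto intro: mono_onD)
  next
    case False
    then have "4 * r\<^sup>2 \<le> s" by simp
    then have "\<phi> s = \<phi> (4 * r\<^sup>2)" using assms unfolding cutoff_def by blast
    then show ?thesis by simp
  qed
qed

lemma diff_le_osc_on:
  assumes "bdd_above (g ` K)" "bdd_below (g ` K)" "x \<in> K" "y \<in> K"
  shows "g y - g x \<le> osc_on K g"
  unfolding osc_on_def using cSUP_upper[OF assms(4,1)] cINF_lower[OF assms(2,3)] by linarith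

section \<open>Uniform ergodicity of the penalized Metropolis chain\<close>

theorem proposition3:
  fixes z0 :: "'a::euclidean_space" and R0 r \<kappa> \<sigma> :: real
    and K U M :: "'a set"
    and g :: "'a \<Rightarrow> real" and G :: "'a \<Rightarrow> 'a" and H :: "'a \<Rightarrow> 'a \<Rightarrow>\<^sub>L 'a"
    and \<phi> :: "real \<Rightarrow> real"
    and P :: "'a \<Rightarrow> 'a measure" and \<nu> :: "'a measure" and \<epsilon> :: real
  assumes "R0 > 0" and "r > 0" and K: "K = cball z0 (R0 + 3 * r)"
    and "open U" and "K \<subseteq> U" and "C2_on U g G H"
    and "bdd_above ((\<lambda>x. norm (G x)) ` K)"
    and "bdd_above ((\<lambda>x. norm (H x)) ` K)"
    and "bdd_above (g ` K)" and "bdd_below (g ` K)"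
    and "cutoff r \<phi>"
    and "compact M" and "M \<noteq> {}"
    and "\<kappa> > 0" and "\<sigma> > 0"
    and P: "P = mh_kernel K g (penalty \<phi> M) \<kappa> \<sigma>"
    and \<nu>: "\<nu> = target K g (penalty \<phi> M) \<kappa>"
    and \<epsilon>: "\<epsilon> = minor_const K g \<phi> r \<kappa> \<sigma>"
  shows "0 < \<epsilon> \<and> \<epsilon> < 1 \<and>
    (\<forall>x\<in>K. \<forall>A\<in>sets (restrict_space borel K).
       measure (P x) A \<ge> \<epsilon> * (measure lborel A / measure lborel K)) \<and>
    reversible_law P \<nu> \<and>
    law_on K \<nu> \<and> invariant_law P \<nu> \<and>
    (\<forall>\<mu>. law_on K \<mu> \<and> invariant_law P \<mu> \<longrightarrow> \<mu> = \<nu>) \<and>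
    (\<forall>\<rho> m. law_on K \<rho> \<longrightarrow>
       tv_dist (step_law P m \<rho>) \<nu> \<le> (1 - \<epsilon>) ^ m * tv_dist \<rho> \<nu> \<and>
       (1 - \<epsilon>) ^ m * tv_dist \<rho> \<nu> \<le> (1 - \<epsilon>) ^ m \<and>
       wasserstein2 (step_law P m \<rho>) \<nu>
         \<le> ennreal (diameter K * (1 - \<epsilon>) powr (real m / 2))) \<and>
    uniformly_geometrically_ergodic K P \<nu>"
proof -
  define \<Psi> where "\<Psi> = penalty \<phi> M"
  have K_compact: "compact K" by (simp add: K)
  have vol: "0 < measure lborel K"
    unfolding K using \<open>R0 > 0\<close> \<open>r > 0\<close> by (intro content_cball_pos) auto
  have cont_g: "continuous_on K g"
    using C2_on_imp_continuous_on[OF \<open>C2_on U g G H\<close>] \<open>K \<subseteq> U\<close> by (rule continuous_on_subset)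
  have cont_\<Psi>: "continuous_on K \<Psi>"
    unfolding \<Psi>_def penalty_def
    by (rule continuous_on_compose2[OF cutoff_continuous_on[OF \<open>cutoff r \<phi>\<close>]])
      (auto intro!: continuous_intros)
  interpret metropolis K g \<Psi> \<kappa> \<sigma>
    by standard (fact K_compact vol cont_g cont_\<Psi> \<open>\<sigma> > 0\<close>)+
  have P_eq: "P = mh_kernel K g \<Psi> \<kappa> \<sigma>" and \<nu>_eq: "\<nu> = target K g \<Psi> \<kappa>"
    by (simp_all add: P \<nu> \<Psi>_def)
  define c where "c = osc_on K g + \<kappa> / 2 * \<phi> (4 * r\<^sup>2)"
  have \<phi>_pos: "0 < \<phi> (4 * r\<^sup>2)"
  proof -
    have "0 < r\<^sup>2" using \<open>r > 0\<close> by simp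
    also have "r\<^sup>2 \<le> \<phi> (4 * r\<^sup>2)"
    proof -
      have "\<forall>s\<ge>r\<^sup>2. r\<^sup>2 \<le> \<phi> s" using \<open>cutoff r \<phi>\<close> unfolding cutoff_def by blast
      then show ?thesis by simp
    qed
    finally show ?thesis .
  qed
  have energy_diff: "energy y - energy x \<le> c" if "x \<in> K" "y \<in> K" for x y
  proof -
    have "\<Psi> y - \<Psi> x \<le> \<phi> (4 * r\<^sup>2)"
      using cutoff_bounds[OF \<open>cutoff r \<phi>\<close>, of "(infdist x M)\<^sup>2"]
        cutoff_bounds[OF \<open>cutoff r \<phi>\<close>, of "(infdist y M)\<^sup>2"] by (simp add: \<Psi>_def penalty_def)
    then have "\<kappa> / 2 * (\<Psi> y - \<Psi> x) \<le> \<kappa> / 2 * \<phi> (4 * r\<^sup>2)"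
      using \<open>\<kappa> > 0\<close> by (intro mult_left_mono) auto
    then show ?thesis
      using diff_le_osc_on[OF \<open>bdd_above (g ` K)\<close> \<open>bdd_below (g ` K)\<close> that] that
      by (simp add: energy_def c_def algebra_simps)
  qed
  have "0 < c"
  proof -
    obtain x where "x \<in> K" using K_ne by auto
    then have "0 \<le> osc_on K g"
      using diff_le_osc_on[OF \<open>bdd_above (g ` K)\<close> \<open>bdd_below (g ` K)\<close>, of x x] by simp
    moreover have "0 < \<kappa> / 2 * \<phi> (4 * r\<^sup>2)" using \<phi>_pos \<open>\<kappa> > 0\<close> by simp
    ultimately show ?thesis unfolding c_def by (rule add_nonneg_pos)
  qed
  have \<epsilon>_eq: "\<epsilon> = measure lborel K * (2 * pi * \<sigma>\<^sup>2) powr (- real DIM('a) / 2) *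
      exp (- (diameter K)\<^sup>2 / (2 * \<sigma>\<^sup>2) - c)"
    by (simp add: \<epsilon> minor_const_def c_def diff_diff_eq)
  have \<epsilon>_pos: "0 < \<epsilon>" using vol \<open>\<sigma> > 0\<close> by (simp add: \<epsilon>_eq)
  have \<epsilon>_less: "\<epsilon> < 1" unfolding \<epsilon>_eq by (rule minorizing_mass_less_1[OF \<open>0 < c\<close>])
  have minor: "\<epsilon> * (measure lborel A / measure lborel K) \<le> measure (P x) A"
    if "x \<in> K" "A \<in> sets S" for x A
    using measure_P_ge[OF that energy_diff[OF that(1)] less_imp_le[OF \<open>0 < c\<close>]] vol
    by (simp add: \<epsilon>_eq P_eq mult_ac)
  \<comment> \<open>The renewal law of the minorization is the uniform law on \<open>K\<close>.\<close>
  define \<eta> where "\<eta> = uniform_measure (restrict_space lborel K) K"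
  have sets_r: "sets (restrict_space lborel K) = sets S" by (simp add: sets_restrict_space)
  have K_r: "emeasure (restrict_space lborel K) A = emeasure lborel A" if "A \<subseteq> K" for A
    using that by (intro emeasure_restrict_space) auto
  have \<eta>_law: "\<eta> \<in> space (prob_algebra S)"
    unfolding \<eta>_def space_prob_algebra using K_vol vol
    by (auto intro!: prob_space_uniform_measure simp: K_r sets_r)
  have \<eta>_eq: "measure \<eta> A = measure lborel A / measure lborel K" if A: "A \<in> sets S" for A
  proof -
    have "A \<subseteq> K" using A by (simp add: sets_S)
    then show ?thesis
      unfolding \<eta>_def using A K_vol vol sets_S sets_r
      by (subst measure_uniform_measure) (auto simp: K_r Int_absorb1 measure_def)
  qed
  have minor_\<eta>: "\<epsilon> * measure \<eta> A \<le> measure (P x) A" if "x \<in> space S" "A \<in> sets S" for x A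
    using minor[of x A] that \<eta>_eq by (simp add: space_S)
  have kernel: "P \<in> S \<rightarrow>\<^sub>M prob_algebra S" unfolding P_eq by (rule P_kernel)
  have \<nu>_law: "law_on K \<nu>" unfolding \<nu>_eq by (rule law_on_target)
  note \<nu>_prob = \<nu>_law[unfolded law_on_iff]
  have rev: "reversible_law P \<nu>" unfolding P_eq \<nu>_eq by (rule reversible_target)
  have inv: "invariant_law P \<nu>" by (rule reversible_imp_invariant[OF \<nu>_prob kernel rev])
  have tv: "tv_dist (step_law P m \<rho>) \<nu> \<le> (1 - \<epsilon>) ^ m * tv_dist \<rho> \<nu>" if "law_on K \<rho>" for \<rho> m
    using that \<epsilon>_pos \<epsilon>_less unfolding law_on_iff
    by (intro tv_dist_step_law_le[OF _ \<nu>_prob kernel \<eta>_law _ _ minor_\<eta> inv]) auto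
  have tv1: "(1 - \<epsilon>) ^ m * tv_dist \<rho> \<nu> \<le> (1 - \<epsilon>) ^ m" if "law_on K \<rho>" for \<rho> m
    using that \<nu>_law \<epsilon>_less tv_dist_le_1[of \<rho> \<nu>] tv_dist_nonneg[of \<rho> \<nu>]
    by (intro mult_left_le) (auto simp: law_on_def)
  have w2: "wasserstein2 (step_law P m \<rho>) \<nu> \<le> ennreal (diameter K * (1 - \<epsilon>) powr (real m / 2))"
    if \<rho>: "law_on K \<rho>" for \<rho> m
  proof -
    have "law_on K (step_law P m \<rho>)"
      using step_law_in_prob_algebra[OF _ kernel] \<rho> by (simp add: law_on_iff)
    from wasserstein2_le_diameter_tv_dist[OF compact_imp_bounded[OF K_compact] this \<nu>_law]
    have "wasserstein2 (step_law P m \<rho>) \<nu> \<le> ennreal (diameter K * sqrt (tv_dist (step_law P m \<rho>) \<nu>))" .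
    also have "\<dots> \<le> ennreal (diameter K * sqrt ((1 - \<epsilon>) ^ m))"
      using order.trans[OF tv[OF \<rho>] tv1[OF \<rho>]] diameter_ge_0[OF compact_imp_bounded[OF K_compact]]
      by (intro ennreal_leI mult_left_mono real_sqrt_le_mono) auto
    also have "sqrt ((1 - \<epsilon>) ^ m) = (1 - \<epsilon>) powr (real m / 2)"
      using \<epsilon>_less by (simp add: powr_half_sqrt[symmetric] powr_realpow[symmetric] powr_powr)
    finally show ?thesis .
  qed
  have "uniformly_geometrically_ergodic K P \<nu>"
    unfolding uniformly_geometrically_ergodic_def
  proof (rule exI[of _ 1], rule exI[of _ "1 - \<epsilon>"], intro conjI ballI allI)
    fix x m assume "x \<in> K"
    then have "law_on K (return S x)"
      by (auto simp: law_on_def space_S intro!: prob_space_return)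
    from order.trans[OF tv[OF this] tv1[OF this]]
    show "tv_dist (step_law P m (return S x)) \<nu> \<le> 1 * (1 - \<epsilon>) ^ m" by simp
  qed (use \<epsilon>_pos \<epsilon>_less in auto)
  moreover have "\<mu> = \<nu>" if "law_on K \<mu>" "invariant_law P \<mu>" for \<mu>
    by (rule invariant_law_unique[OF that(1)[unfolded law_on_iff] \<nu>_prob kernel \<eta>_law \<epsilon>_pos
          less_imp_le[OF \<epsilon>_less] minor_\<eta> that(2) inv])
  ultimately show ?thesis
    using \<epsilon>_pos \<epsilon>_less minor rev \<nu>_law inv tv tv1 w2 by blast
qed

end
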